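(* Let $q$ be a prime power, $t\ge 1$, $\mathbb{B}=\mathrm{GF}(q)$, $\mathbb{F}=\mathrm{GF}(q^t)$, $n=q^t$, let $\omega$ be a primitive element of $\mathbb{F}$, and let $1\le k\le n-q^{t-1}$. Let $(\mathcal{U},s,R)$ be the output of Algorithm O for these parameters, where $\mathcal{U}$ is the set of valid cyclotomic cosets, $s$ is the prescribed size $|\mathcal{S}|$ and $R=|\mathcal{S}|+\dim(\mathcal{W}_{k,\mathcal{S}})$, and let $d=\dim(\mathcal{V}_{k,\mathcal{S}})=\dim(\mathcal{W}_{k,\mathcal{S}})=\sum_{C\in\mathcal{U}}|C|$. Fix $r$, set $\mathcal{I}=\{\omega^r,\omega^{r+1},\dots,\omega^{r+d-1}\}$, and let $\mathcal{S}$ be any subset of $(\mathbb{F}\setminus\{0\})\setminus\mathcal{I}$ of the given size $s$. Then, by downloading $\mathrm{Tr}(g(\alpha)c(\alpha)/\alpha)$ for all $\alpha\in(\mathbb{F}\setminus\{0\})\setminus(\mathcal{I}\cup\mathcal{S})$, it is possible to recover $\mathrm{Tr}(g(\alpha)c(\alpha)/\alpha)$ for all $\alpha\in\mathcal{I}$. Hence $c(0)$ is repaired with bandwidth $(n-1-R)\log|\mathbb{B}|$ bits.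
   Context: $\mathrm{Tr}:\mathbb{F}\to\mathbb{B}$ is the field trace and $\log$ is to base 2. The setting is the full-length Reed-Solomon code $\mathrm{RS}(\mathbb{F},k)=\{(c(\alpha))_{\alpha\in\mathbb{F}}: c\in\mathbb{F}[x],\deg c\le k-1\}$; $(c(\alpha))_{\alpha\in\mathbb{F}}$ is a codeword with $c(0)$ erased; node $\alpha\ne 0$ stores $c(\alpha)$, and downloading one element of $\mathbb{B}$ costs $\log|\mathbb{B}|$ bits. For $\mathcal{S}\subset\mathbb{F}\setminus\{0\}$ put $g(x)=\prod_{\beta\in\mathcal{S}}(x-\beta)$ ($g=1$ if $\mathcal{S}=\emptyset$). $\mathcal{V}_{k,\mathcal{S}}$ is the $\mathbb{B}$-space of polynomials $T\in\mathbb{F}[x]$ such that $T(\mathbb{F})\subseteq\mathbb{B}$ and the polynomial $h(x)=g(x)T(x)/x$ satisfies $h(0)=0$ and $\deg h\le n-k-1$; $\mathcal{W}_{k,\mathcal{S}}$ is the $\mathbb{B}$-space of the evaluation vectors $(h(\alpha))_{\alpha\in\mathbb{F}}$ of these $h$. Dimensions are over $\mathbb{B}$. Cyclotomic cosets: $\Xi$ is the collection of orbits of $\{0,1,\dots,q^t-2\}$ under $a\mapsto qa\bmod(q^t-1)$. Algorithm O (parameters $q,t,k$) records a list of configurations $(\mathcal{U},s,R)$ as follows. (O1) If $k\ge 2$, set $\mathcal{U}=\{C\in\Xi: 0\notin C,1\notin C,\max(C)\le n-k\}$. If $k=1$, start with $\mathcal{U}=\{C\in\Xi:1\notin C\}$;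 in the first iteration record this $\mathcal{U}$ with $s=0$ and $R=\sum_{C\in\mathcal{U}}|C|$, and prune $\{0\}$ from $\mathcal{U}$. (O2) While $\mathcal{U}\ne\emptyset$: let $\beta=\max_{C\in\mathcal{U}}\max(C)$ and let $C_{\max}\in\mathcal{U}$ be the coset containing $\beta$; put $s=n-k-\beta$ and $R=s+\sum_{C\in\mathcal{U}}|C|$; record $(\mathcal{U},s,R)$; replace $\mathcal{U}$ by $\mathcal{U}\setminus\{C_{\max}\}$. (O3) Record $(\emptyset,\,n-k-q^{t-1},\,n-k-q^{t-1})$. (O4) Output a recorded configuration with $R$ maximal.
   Formalization: In step (O1), "1 ∉ C" is read with 1 taken modulo q^t−1; this changes only the case q=2, t=1, k=1, where the literal algorithm outputs U={{0}}, R=1 although dim V=0 and c(0) cannot be repaired with 0 bits. *)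

theory Defs
  imports
    "HOL-Analysis.Finite_Cartesian_Product"
    "HOL-Computational_Algebra.Computational_Algebra"
    "HOL-Library.FuncSet"
begin

section \<open>The extension $\mathbb{F}/\mathbb{B}$\<close>

text \<open>
  The subfield of order $q$ is a type \<open>'b\<close> together with an embedding into \<open>'f\<close>, so that
  dimensions over it are dimensions in the sense of the library's vector space locale.
  A unital ring homomorphism between fields is automatically injective.
\<close>

definition field_embedding :: "('b::finite_field \<Rightarrow> 'f::finite_field) \<Rightarrow> bool" where
  "field_embedding emb \<longleftrightarrow>
     emb 1 = 1 \<and> (\<forall>x y. emb (x + y) = emb x + emb y) \<and> (\<forall>x y. emb (x * y) = emb x * emb y)"

text \<open>
  The trace $\sum_{i<t} x^{q^i}$ of an extension of degree \<open>t\<close>, read as an element of the base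
  field; that this sum lies in the range of \<open>emb\<close> is \<open>emb_field_trace\<close> below.
\<close>

definition field_trace :: "('b::finite_field \<Rightarrow> 'f::finite_field) \<Rightarrow> nat \<Rightarrow> 'f \<Rightarrow> 'b" where
  "field_trace emb t x = the_inv emb (\<Sum>i<t. x ^ (CARD('b) ^ i))"

definition primitive_element :: "'f::finite_field \<Rightarrow> bool" where
  "primitive_element \<omega> \<longleftrightarrow> \<omega> \<noteq> 0 \<and> (\<forall>x. x \<noteq> 0 \<longrightarrow> (\<exists>i::nat. x = \<omega> ^ i))"

definition poly_dim :: "('b::finite_field \<Rightarrow> 'f::finite_field) \<Rightarrow> 'f poly set \<Rightarrow> nat" where
  "poly_dim emb = vector_space.dim (\<lambda>b p. smult (emb b) p)"

definition vec_dim ::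
  "('b::finite_field \<Rightarrow> 'f::finite_field) \<Rightarrow> ('f ^ 'n::finite) set \<Rightarrow> nat" where
  "vec_dim emb = vector_space.dim (\<lambda>b v. emb b *s v)"

section \<open>Reed--Solomon codes and repair of the symbol at 0\<close>

text \<open>
  Codewords are vectors indexed by the field itself. The parameter \<open>k\<close> is meant to be positive.
\<close>

definition RS :: "nat \<Rightarrow> ('f, 'f::finite_field) vec set" where
  "RS k = {(\<chi> \<alpha>. poly c \<alpha>) | c. degree c \<le> k - 1}"

text \<open>
  In the next three definitions, \<open>\<phi> \<alpha> y\<close> is the element of the base field computed at node
  \<open>\<alpha>\<close> from its content \<open>y\<close>, and \<open>D\<close> is the set of nodes whose elements are downloaded. The
  recovery maps \<open>\<rho>\<close> see only the downloaded elements and do not depend on the codeword.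
\<close>

definition recoverable ::
  "nat \<Rightarrow> ('f::finite_field \<Rightarrow> 'f \<Rightarrow> 'b::finite_field) \<Rightarrow> 'f set \<Rightarrow> 'f set \<Rightarrow> bool" where
  "recoverable k \<phi> D A \<longleftrightarrow>
     (\<exists>\<rho> :: ('f \<Rightarrow> 'b) \<Rightarrow> 'f \<Rightarrow> 'b. \<forall>v \<in> RS k. \<forall>\<alpha> \<in> A.
        \<rho> (\<lambda>\<beta>\<in>D. \<phi> \<beta> (v $ \<beta>)) \<alpha> = \<phi> \<alpha> (v $ \<alpha>))"

definition repairs_origin ::
  "nat \<Rightarrow> ('f::finite_field \<Rightarrow> 'f \<Rightarrow> 'b::finite_field) \<Rightarrow> 'f set \<Rightarrow> bool" where
  "repairs_origin k \<phi> D \<longleftrightarrow>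
     D \<subseteq> UNIV - {0} \<and>
     (\<exists>\<rho> :: ('f \<Rightarrow> 'b) \<Rightarrow> 'f. \<forall>v \<in> RS k. \<rho> (\<lambda>\<beta>\<in>D. \<phi> \<beta> (v $ \<beta>)) = v $ 0)"

text \<open>In bits; \<open>\<phi>\<close> only determines the type, hence the size, of a downloaded element.\<close>

definition bandwidth ::
  "('f::finite_field \<Rightarrow> 'f \<Rightarrow> 'b::finite_field) \<Rightarrow> 'f set \<Rightarrow> real" where
  "bandwidth \<phi> D = (\<Sum>\<alpha>\<in>D. log 2 (real CARD('b)))"

section \<open>The spaces $\mathcal{V}_{k,\mathcal{S}}$ and $\mathcal{W}_{k,\mathcal{S}}$\<close>

definition g_poly :: "'f::finite_field set \<Rightarrow> 'f poly" where
  "g_poly S = (\<Prod>\<beta>\<in>S. [:- \<beta>, 1:])"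

definition h_poly :: "'f::finite_field set \<Rightarrow> 'f poly \<Rightarrow> 'f poly" where
  "h_poly S T = (g_poly S * T) div [:0, 1:]"

definition V_space ::
  "('b::finite_field \<Rightarrow> 'f::finite_field) \<Rightarrow> nat \<Rightarrow> 'f set \<Rightarrow> 'f poly set" where
  "V_space emb k S =
     {T. range (poly T) \<subseteq> range emb \<and> [:0, 1:] dvd g_poly S * T \<and>
         poly (h_poly S T) 0 = 0 \<and> degree (h_poly S T) \<le> CARD('f) - k - 1}"

definition W_space ::
  "('b::finite_field \<Rightarrow> 'f::finite_field) \<Rightarrow> nat \<Rightarrow> 'f set \<Rightarrow> ('f, 'f) vec set" where
  "W_space emb k S = (\<lambda>T. \<chi> \<alpha>. poly (h_poly S T) \<alpha>) ` V_space emb k S"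

definition trace_query ::
  "('b::finite_field \<Rightarrow> 'f::finite_field) \<Rightarrow> nat \<Rightarrow> 'f set \<Rightarrow> 'f \<Rightarrow> 'f \<Rightarrow> 'b" where
  "trace_query emb t S \<alpha> y = field_trace emb t (poly (g_poly S) \<alpha> * y / \<alpha>)"

section \<open>Algorithm O\<close>

definition cyclotomic_cosets :: "nat \<Rightarrow> nat \<Rightarrow> nat set set" where
  "cyclotomic_cosets q t =
     (\<lambda>a. {((\<lambda>b. q * b mod (q ^ t - 1)) ^^ i) a | i. True}) ` {..<q ^ t - 1}"

text \<open>
  The exponent 1 is taken modulo $q^t - 1$, like all other exponents. This is just 1 unless
  $q^t = 2$, where the only coset is $\{0\}$ and $x = x^{q^t-1}$ as functions.
\<close>

definition initial_cosets :: "nat \<Rightarrow> nat \<Rightarrow> nat \<Rightarrow> nat set set" where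
  "initial_cosets q t k =
     (if k = 1 then {C \<in> cyclotomic_cosets q t. 1 mod (q ^ t - 1) \<notin> C}
      else {C \<in> cyclotomic_cosets q t. 0 \<notin> C \<and> 1 mod (q ^ t - 1) \<notin> C \<and> Max C \<le> q ^ t - k})"

text \<open>The values taken by \<open>\<U>\<close> during the loop, including the final empty set.\<close>

inductive_set loop_cosets :: "nat \<Rightarrow> nat \<Rightarrow> nat \<Rightarrow> nat set set set" for q t k where
  start: "(if k = 1 then initial_cosets q t k - {{0}} else initial_cosets q t k)
            \<in> loop_cosets q t k"
| prune: "U \<in> loop_cosets q t k \<Longrightarrow> U \<noteq> {} \<Longrightarrow> C \<in> U \<Longrightarrow> Max (Max ` U) \<in> C
            \<Longrightarrow> U - {C} \<in> loop_cosets q t k"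

inductive_set recorded :: "nat \<Rightarrow> nat \<Rightarrow> nat \<Rightarrow> (nat set set \<times> nat \<times> nat) set" for q t k where
  first: "k = 1 \<Longrightarrow> U = initial_cosets q t k \<Longrightarrow> (U, 0, \<Sum>C\<in>U. card C) \<in> recorded q t k"
| loop: "U \<in> loop_cosets q t k \<Longrightarrow> U \<noteq> {} \<Longrightarrow> s = q ^ t - k - Max (Max ` U)
           \<Longrightarrow> (U, s, s + (\<Sum>C\<in>U. card C)) \<in> recorded q t k"
| final: "s = q ^ t - k - q ^ (t - 1) \<Longrightarrow> ({}, s, s) \<in> recorded q t k"

text \<open>Ties may be broken arbitrarily, so there can be several outputs.\<close>

definition algorithm_O_output :: "nat \<Rightarrow> nat \<Rightarrow> nat \<Rightarrow> nat set set \<times> nat \<times> nat \<Rightarrow> bool" where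
  "algorithm_O_output q t k = (\<lambda>(U, s, R). (U, s, R) \<in> recorded q t k \<and>
     (\<forall>(U', s', R') \<in> recorded q t k. R' \<le> R))"

section \<open>Well-definedness\<close>

lemma field_embedding_0: "field_embedding emb \<Longrightarrow> emb 0 = 0"
  unfolding field_embedding_def by (metis add.right_neutral add_left_cancel)

lemma field_embedding_power: "field_embedding emb \<Longrightarrow> emb (x ^ m) = emb x ^ m"
  by (induction m) (auto simp: field_embedding_def)

lemma field_embedding_inj:
  assumes "field_embedding emb"
  shows "inj emb"
proof (rule injI, rule ccontr)
  fix x y assume xy: "emb x = emb y" "x \<noteq> y"
  have "emb x = emb (x - y) + emb y"
    using assms unfolding field_embedding_def by (metis diff_add_cancel)
  then have "emb (x - y) = 0" using xy by simp
  moreover have "emb (x - y) * emb (inverse (x - y)) = 1"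
    using assms xy unfolding field_embedding_def
    by (metis right_inverse right_minus_eq)
  ultimately show False by simp
qed

lemma vector_space_poly:
  "field_embedding emb \<Longrightarrow> vector_space (\<lambda>b p. smult (emb b) p)"
  by unfold_locales (auto simp: field_embedding_def smult_add_left smult_add_right)

lemma vector_space_vec:
  "field_embedding emb \<Longrightarrow> vector_space (\<lambda>b (v :: 'f::finite_field ^ 'n::finite). emb b *s v)"
  by unfold_locales (auto simp: field_embedding_def vec_eq_iff algebra_simps)

lemma range_embI:
  fixes emb :: "'b::finite_field \<Rightarrow> 'f::finite_field"
  assumes "field_embedding emb" "y ^ CARD('b) = y"
  shows "y \<in> range emb"
proof -
  let ?q = "CARD('b)"
  let ?P = "monom 1 ?q - monom 1 1 :: 'f poly"
  have "card {0, 1 :: 'b} \<le> ?q" by (intro card_mono) auto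
  then have q: "?q > 1" by simp
  have c: "coeff ?P ?q = 1" using q by simp
  then have P0: "?P \<noteq> 0" by (metis coeff_0 zero_neq_one)
  have "degree ?P \<le> ?q" using q by (intro degree_diff_le) (auto simp: degree_monom_eq)
  then have "card {x. poly ?P x = 0} \<le> ?q" using card_poly_roots_bound[OF P0] by simp
  moreover have sub: "range emb \<subseteq> {x. poly ?P x = 0}"
    by (auto simp: poly_monom simp flip: field_embedding_power[OF assms(1)]
        simp: finite_field_power_card_eq_same)
  moreover have "card (range emb) = ?q"
    using field_embedding_inj[OF assms(1)] by (simp add: card_image)
  ultimately have "range emb = {x. poly ?P x = 0}"
    by (intro card_seteq) simp_all
  then show ?thesis using assms(2) by (auto simp: poly_monom)
qed

lemma power_card_add:
  fixes emb :: "'b::finite_field \<Rightarrow> 'f::finite_field" and x y :: 'f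
  assumes "field_embedding emb"
  shows "(x + y) ^ CARD('b) = x ^ CARD('b) + y ^ CARD('b)"
proof -
  let ?q = "CARD('b)"
  let ?P = "[:1, 1:] ^ ?q - monom 1 ?q - 1 :: 'f poly"
  have q0: "?q > 0" by simp
  have "?P = 0"
  proof (rule ccontr)
    assume P0: "?P \<noteq> 0"
    have "degree ([:1, 1:] ^ ?q :: 'f poly) = ?q" by (simp add: degree_power_eq)
    moreover have "lead_coeff ([:1, 1:] ^ ?q :: 'f poly) = 1" by (simp add: lead_coeff_power)
    ultimately have "coeff ?P ?q = 0" using q0 by simp
    moreover have "degree ?P \<le> ?q"
      by (intro degree_diff_le) (auto simp: degree_power_eq degree_monom_eq)
    ultimately have d: "degree ?P < ?q"
      using P0 by (metis le_neq_implies_less leading_coeff_0_iff)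
    have sub: "range emb \<subseteq> {x. poly ?P x = 0}"
    proof safe
      fix b
      have "emb ((1 + b) ^ ?q) = emb (1 + b)"
        by (simp add: finite_field_power_card_eq_same)
      then have "(1 + emb b) ^ ?q = 1 + emb b"
        using assms by (simp add: field_embedding_power[OF assms]) (simp add: field_embedding_def)
      moreover have "emb b ^ ?q = emb b"
        by (simp add: finite_field_power_card_eq_same flip: field_embedding_power[OF assms])
      ultimately show "poly ?P (emb b) = 0" by (simp add: poly_monom)
    qed
    have "card (range emb) = ?q"
      using field_embedding_inj[OF assms] by (simp add: card_image)
    then show False
      using card_mono[OF _ sub] card_poly_roots_bound[OF P0] d by simp
  qed
  then have *: "(1 + z) ^ ?q = 1 + z ^ ?q" for z :: 'f
  proof -
    have "poly ?P z = 0" using \<open>?P = 0\<close> by (metis poly_0)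
    then show ?thesis by (simp add: poly_monom algebra_simps)
  qed
  show ?thesis
  proof (cases "y = 0")
    case False
    have "x + y = y * (1 + x / y)" using False by (simp add: distrib_left)
    then have "(x + y) ^ ?q = (y * (1 + x / y)) ^ ?q" by simp
    also have "\<dots> = y ^ ?q * (1 + (x / y) ^ ?q)" by (simp only: power_mult_distrib *)
    also have "\<dots> = x ^ ?q + y ^ ?q" using False by (simp add: power_divide field_simps)
    finally show ?thesis .
  qed (use q0 in \<open>simp add: power_0_left\<close>)
qed

lemma emb_field_trace:
  fixes emb :: "'b::finite_field \<Rightarrow> 'f::finite_field"
  assumes emb: "field_embedding emb" and t: "CARD('f) = CARD('b) ^ t"
  shows "emb (field_trace emb t x) = (\<Sum>i<t. x ^ (CARD('b) ^ i))"
proof -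
  let ?q = "CARD('b)" and ?s = "\<Sum>i<t. x ^ (CARD('b) ^ i)"
  have sum_pow: "(\<Sum>i\<in>A. f i) ^ ?q = (\<Sum>i\<in>A. f i ^ ?q)" if "finite A" for A and f :: "nat \<Rightarrow> 'f"
    using that by (induction A) (simp_all add: power_card_add[OF emb] power_0_left)
  have "?s ^ ?q = (\<Sum>i<t. x ^ (?q ^ Suc i))"
    by (subst sum_pow) (simp_all add: mult.commute flip: power_mult)
  also have "\<dots> + x = (\<Sum>i<Suc t. x ^ (?q ^ i))"
    by (subst sum.lessThan_Suc_shift) simp
  also have "\<dots> = ?s + x"
    using finite_field_power_card_eq_same[of x] by (simp add: t)
  finally have "?s \<in> range emb" by (intro range_embI[OF emb]) simp
  then show ?thesis
    unfolding field_trace_def by (intro f_the_inv_into_f field_embedding_inj[OF emb])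
qed

end

theory Submission
  imports Defs
begin

text \<open>
  Reading exponents modulo \<open>n - 1\<close>, with \<open>n - 1\<close> in the role of the class 0, every recorded
  configuration \<open>\<U>\<close> consists of exactly those cosets whose exponents lie between 2 and
  \<open>n - k - s\<close>. A polynomial with values in the base field
  equals its own \<open>q\<close>-th power as a function, so its support is a union of cosets, and
  \<open>V_space\<close> is the set of base-field-valued polynomials with exponents in \<open>A = \<Union>\<U>\<close>. By a
  Vandermonde argument, polynomials with exponents in \<open>A\<close> are determined by arbitrary values on
  \<open>d = card A\<close> consecutive powers of \<open>\<omega>\<close>, and base-field values there force base-field values
  everywhere. Hence evaluation on \<open>I\<close> identifies \<open>V_space\<close> with the base-field-valued functions
  on \<open>I\<close>; its dual basis gives the dimensions, and parity checks that isolate each node of \<open>I\<close>.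
  Once all traces are known, the parity checks \<open>g(x) Tr(\<gamma> x) / x\<close> determine the symbol at 0.
\<close>

section \<open>Cyclotomic cosets and Algorithm O\<close>

definition coset :: "nat \<Rightarrow> nat \<Rightarrow> nat \<Rightarrow> nat set" where
  "coset q t a = {q ^ i * a mod (q ^ t - 1) | i. True}"

text \<open>The exponent in \<open>{1..N}\<close> representing the class of \<open>a\<close> modulo \<open>N\<close>.\<close>

definition lift_exp :: "nat \<Rightarrow> nat \<Rightarrow> nat" where
  "lift_exp N a = (if a = 0 then N else a)"

lemma cyclotomic_cosets_eq: "cyclotomic_cosets q t = coset q t ` {..<q ^ t - 1}"
proof -
  have "((\<lambda>b. q * b mod (q ^ t - 1)) ^^ i) a = q ^ i * a mod (q ^ t - 1)"
    if "a < q ^ t - 1" for a i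
    using that by (induction i) (simp_all add: mod_mult_right_eq mult.assoc)
  then show ?thesis unfolding cyclotomic_cosets_def coset_def by (intro image_cong) auto
qed

lemma coset_self: "a < q ^ t - 1 \<Longrightarrow> a \<in> coset q t a"
  unfolding coset_def by (rule CollectI, rule exI[of _ 0]) simp

lemma coset_subset: "coset q t a \<subseteq> {..<q ^ t - 1}" if "a < q ^ t - 1"
  using that by (auto simp: coset_def)

lemma coset_subset_coset: "b \<in> coset q t a \<Longrightarrow> coset q t b \<subseteq> coset q t a"
  unfolding coset_def by (auto simp: mod_mult_right_eq simp flip: mult.assoc power_add)

text \<open>Since \<open>q ^ t\<close> is 1 modulo \<open>q ^ t - 1\<close>, multiplication by
  \<open>q\<close> is invertible on residues. This is what makes forward orbits equivalence
  classes.\<close>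

lemma power_mult_cong_1:
  fixes q :: nat
  assumes "q > 0"
  shows "q ^ (t * i) * a mod (q ^ t - 1) = a mod (q ^ t - 1)"
proof -
  have "q ^ t = (q ^ t - 1) + 1" using assms by simp
  then have "q ^ t mod (q ^ t - 1) = 1 mod (q ^ t - 1)" by (metis mod_add_self1)
  then have "(q ^ t) ^ i mod (q ^ t - 1) = 1 mod (q ^ t - 1)"
    by (metis power_mod power_one)
  then show ?thesis by (metis mod_mult_left_eq mult_1 power_mult)
qed

lemma coset_eq:
  assumes "b \<in> coset q t a" "a < q ^ t - 1"
  shows "coset q t b = coset q t a"
proof -
  obtain i where b: "b = q ^ i * a mod (q ^ t - 1)" using assms by (auto simp: coset_def)
  have t: "t > 0" using assms(2) by (cases t) auto
  have "q > 0" using assms(2) t by (cases "q = 0") (auto simp: power_0_left)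
  from power_mult_cong_1[OF this, of t i a]
  have 1: "q ^ (t * i) * a mod (q ^ t - 1) = a" using assms(2) by simp
  \<comment> \<open>Going on around the cycle undoes the first \<open>i\<close> steps. The exponent
    \<open>t * i - i\<close> does not underflow because \<open>t > 0\<close>.\<close>
  have "q ^ (t * i - i) * b mod (q ^ t - 1) = q ^ (t * i - i) * q ^ i * a mod (q ^ t - 1)"
    unfolding b by (simp add: mod_mult_right_eq mult.assoc)
  also have "q ^ (t * i - i) * q ^ i = q ^ (t * i)"
    using t by (simp flip: power_add)
  finally have "a = q ^ (t * i - i) * b mod (q ^ t - 1)" using 1 by simp
  then have "a \<in> coset q t b" unfolding coset_def by blast
  then show ?thesis using assms coset_subset_coset by blast
qed

lemma card_Union_cosets:
  assumes "U \<subseteq> cyclotomic_cosets q t"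
  shows "card (\<Union>U) = (\<Sum>C\<in>U. card C)"
proof (rule card_Union_disjoint)
  show "pairwise disjnt U"
  proof (rule pairwiseI)
    fix C D assume CD: "C \<in> U" "D \<in> U" "C \<noteq> D"
    then obtain a b where "a < q ^ t - 1" "b < q ^ t - 1" "C = coset q t a" "D = coset q t b"
      using assms unfolding cyclotomic_cosets_eq by blast
    then show "disjnt C D" using CD(3) coset_eq unfolding disjnt_iff by metis
  qed
  show "finite C" if "C \<in> U" for C
    using that assms coset_subset unfolding cyclotomic_cosets_eq
    by (metis (no_types, lifting) finite_lessThan finite_subset imageE lessThan_iff subsetD)
qed

text \<open>Multiply by \<open>q\<close> until the top base-\<open>q\<close> digit is nonzero.\<close>

lemma coset_large_element:
  fixes q t a :: nat
  assumes "q \<ge> 2" "0 < a" "a < q ^ t - 1"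
  obtains j where "q ^ (t - 1) \<le> q ^ j * a" "q ^ j * a < q ^ t - 1"
proof -
  let ?P = "\<lambda>j. q ^ (t - 1) \<le> q ^ j * a"
  define j where "j = (LEAST j. ?P j)"
  have "?P (t - 1)" using assms by simp
  then have j: "?P j" unfolding j_def by (rule LeastI)
  have t: "t > 0" using assms(3) by (cases t) auto
  have "q ^ j * a < q ^ t - 1"
  \<comment> \<open>By minimality the preceding product is at most \<open>q ^ (t - 1) - 1\<close>,
    so this one is at most \<open>q ^ t - q\<close>, which is below \<open>q ^ t - 1\<close> because
    \<open>q \<ge> 2\<close>.\<close>
  proof (cases j)
    case (Suc i)
    have "\<not> ?P i" using not_less_Least[of i ?P] Suc j_def by simp
    then have "q ^ i * a + 1 \<le> q ^ (t - 1)" by simp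
    then have "q * (q ^ i * a + 1) \<le> q * q ^ (t - 1)" by (rule mult_le_mono2)
    also have "\<dots> = q ^ t" using t by (metis power_eq_if not_gr_zero)
    finally show ?thesis using Suc assms(1) by (simp add: algebra_simps)
  qed (use assms in simp)
  with j show ?thesis by (rule that)
qed

lemma Max_coset:
  assumes "a < q ^ t - 1"
  shows "Max (coset q t a) \<in> coset q t a" "Max (coset q t a) \<le> m \<longleftrightarrow> (\<forall>b\<in>coset q t a. b \<le> m)"
proof -
  have "finite (coset q t a)" using coset_subset[OF assms] finite_subset by blast
  moreover have "coset q t a \<noteq> {}" using coset_self[OF assms] by blast
  ultimately show "Max (coset q t a) \<in> coset q t a"
    "Max (coset q t a) \<le> m \<longleftrightarrow> (\<forall>b\<in>coset q t a. b \<le> m)" by auto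
qed

section \<open>The loop of Algorithm O as a descending threshold\<close>

lemma coset_contains_0:
  assumes "0 \<in> coset q t a" "a < q ^ t - 1"
  shows "a = 0"
proof -
  have "coset q t 0 = {0}" by (auto simp: coset_def)
  then show ?thesis using coset_eq[OF assms] coset_self[OF assms(2)] by auto
qed

text \<open>Loop invariant: only one coset contains the current overall maximum, so pruning it
  amounts to lowering the threshold \<open>m\<close> to just below that maximum.\<close>

lemma loop_cosets_eq:
  assumes "U \<in> loop_cosets q t k" "1 \<le> k"
  shows "\<exists>m\<le>q ^ t - k. U = {C \<in> cyclotomic_cosets q t. 0 \<notin> C \<and> 1 mod (q ^ t - 1) \<notin> C \<and> Max C \<le> m}"
  using assms(1)
proof induction
  case start
  show ?case
  proof (intro exI[of _ "q ^ t - k"] conjI order_refl)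
    \<comment> \<open>For \<open>k = 1\<close> the initial family has no bound on
      \<open>Max C\<close> and still contains \<open>{0}\<close>. The bound \<open>q ^ t - 1\<close>
      holds for every coset, and deleting \<open>{0}\<close> is the same as excluding the element
      0.\<close>
    have "C = {0} \<longleftrightarrow> 0 \<in> C" "Max C \<le> q ^ t - 1" if C: "C \<in> cyclotomic_cosets q t" for C
    proof -
      obtain a where a: "a < q ^ t - 1" "C = coset q t a"
        using C by (auto simp: cyclotomic_cosets_eq)
      have "coset q t 0 = {0}" by (auto simp: coset_def)
      then show "C = {0} \<longleftrightarrow> 0 \<in> C" using a coset_contains_0 by auto
      show "Max C \<le> q ^ t - 1" unfolding a(2) Max_coset(2)[OF a(1)]
        using coset_subset[OF a(1)] by auto
    qed
    then show "(if k = 1 then initial_cosets q t k - {{0}} else initial_cosets q t k) =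
      {C \<in> cyclotomic_cosets q t. 0 \<notin> C \<and> 1 mod (q ^ t - 1) \<notin> C \<and> Max C \<le> q ^ t - k}"
      by (auto simp: initial_cosets_def)
  qed
next
  case (prune U C)
  then obtain m where m: "m \<le> q ^ t - k"
    "U = {C \<in> cyclotomic_cosets q t. 0 \<notin> C \<and> 1 mod (q ^ t - 1) \<notin> C \<and> Max C \<le> m}" by blast
  let ?\<beta> = "Max (Max ` U)"
  have fin: "finite U" unfolding m(2) cyclotomic_cosets_eq by simp
  have CU: "\<exists>a<q ^ t - 1. D = coset q t a" if "D \<in> U" for D
    using that m(2) by (auto simp: cyclotomic_cosets_eq)
  have le: "Max D \<le> ?\<beta>" if "D \<in> U" for D using that fin by simp
  have C\<beta>: "Max C = ?\<beta>"
  proof (rule antisym)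
    obtain a where "a < q ^ t - 1" "C = coset q t a" using CU prune by blast
    then show "?\<beta> \<le> Max C" using prune Max_coset(2) by blast
  qed (use le prune in blast)
  have uniq: "D = C" if D: "D \<in> U" "Max D = ?\<beta>" for D
  proof -
    obtain a where a: "a < q ^ t - 1" "C = coset q t a" using CU[OF prune(3)] by blast
    obtain b where b: "b < q ^ t - 1" "D = coset q t b" using CU[OF D(1)] by blast
    have "?\<beta> \<in> D" using Max_coset(1)[OF b(1)] b(2) D(2) by metis
    then show ?thesis using coset_eq a b prune(4) by metis
  qed
  \<comment> \<open>Ensures that the new threshold \<open>?\<beta> - 1\<close> is really smaller in
    natural subtraction.\<close>
  have "0 < ?\<beta>"
    using prune m(2) by (cases "?\<beta> = 0") auto
  have "?\<beta> \<le> m" using C\<beta> prune m(2) by auto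
  have "U - {C} = {D \<in> cyclotomic_cosets q t. 0 \<notin> D \<and> 1 mod (q ^ t - 1) \<notin> D \<and> Max D \<le> ?\<beta> - 1}"
  proof (intro set_eqI iffI)
    fix D assume "D \<in> U - {C}"
    then have "Max D \<le> ?\<beta>" "Max D \<noteq> ?\<beta>" "D \<in> U" using le uniq by auto
    then show "D \<in> {D \<in> cyclotomic_cosets q t. 0 \<notin> D \<and> 1 mod (q ^ t - 1) \<notin> D \<and> Max D \<le> ?\<beta> - 1}"
      using m(2) by auto
  next
    fix D assume *: "D \<in> {D \<in> cyclotomic_cosets q t. 0 \<notin> D \<and> 1 mod (q ^ t - 1) \<notin> D \<and> Max D \<le> ?\<beta> - 1}"
    then have "Max D \<le> m" "Max D \<noteq> ?\<beta>" using \<open>0 < ?\<beta>\<close> \<open>?\<beta> \<le> m\<close> by auto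
    then show "D \<in> U - {C}" using * m(2) C\<beta> by auto
  qed
  then show ?case using \<open>?\<beta> \<le> m\<close> m(1) by (intro exI[of _ "?\<beta> - 1"]) auto
qed

section \<open>From families of cosets to sets of admissible exponents\<close>

lemma Union_cosets_eq:
  assumes P: "\<And>C. C \<in> U \<longleftrightarrow> C \<in> cyclotomic_cosets q t \<and> (\<forall>b\<in>C. P b)"
  shows "\<Union>U = {a. a < q ^ t - 1 \<and> (\<forall>i. P (q ^ i * a mod (q ^ t - 1)))}"
proof (intro set_eqI iffI)
  fix a assume "a \<in> \<Union>U"
  then obtain C where C: "C \<in> U" "a \<in> C" by blast
  then obtain c where "C = coset q t c" "c < q ^ t - 1"
    using P[of C] by (auto simp: cyclotomic_cosets_eq)
  then have c: "a \<in> coset q t c" "c < q ^ t - 1" "\<forall>b\<in>coset q t c. P b"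
    using C P[of C] by auto
  then have "coset q t a = coset q t c" "a < q ^ t - 1" using coset_eq coset_subset by blast+
  then show "a \<in> {a. a < q ^ t - 1 \<and> (\<forall>i. P (q ^ i * a mod (q ^ t - 1)))}"
    using c(3) by (auto simp: coset_def)
next
  fix a assume a: "a \<in> {a. a < q ^ t - 1 \<and> (\<forall>i. P (q ^ i * a mod (q ^ t - 1)))}"
  then have "coset q t a \<in> U" unfolding P cyclotomic_cosets_eq by (auto simp: coset_def)
  then show "a \<in> \<Union>U" using a coset_self by blast
qed

text \<open>The lower bound 2 reflects the vanishing of the two lowest coefficients of
  \<open>T\<close> in \<open>V_space\<close>; \<open>m\<close> will be the degree bound
  \<open>n - k - card S\<close>. Quantifying over \<open>i\<close> imposes both on whole
  orbits.\<close>

definition admissible :: "nat \<Rightarrow> nat \<Rightarrow> nat \<Rightarrow> nat set" where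
  "admissible q t m =
     {a. a < q ^ t - 1 \<and> (\<forall>i. lift_exp (q ^ t - 1) (q ^ i * a mod (q ^ t - 1)) \<in> {2..m})}"

text \<open>The class 0 lifts to \<open>q ^ t - 1\<close>, which lies above \<open>m\<close>, and
  the class 1 lies below 2. So a single interval condition expresses both exclusions of the
  algorithm.\<close>

lemma Union_cosets_admissible:
  assumes "m \<le> q ^ t - 2"
  shows "\<Union>{C \<in> cyclotomic_cosets q t. 0 \<notin> C \<and> 1 mod (q ^ t - 1) \<notin> C \<and> Max C \<le> m}
    = admissible q t m"
  unfolding admissible_def
proof (rule Union_cosets_eq)
  fix C
  let ?N = "q ^ t - 1"
  show "C \<in> {C \<in> cyclotomic_cosets q t. 0 \<notin> C \<and> 1 mod ?N \<notin> C \<and> Max C \<le> m} \<longleftrightarrow>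
    C \<in> cyclotomic_cosets q t \<and> (\<forall>b\<in>C. lift_exp ?N b \<in> {2..m})"
  proof (cases "C \<in> cyclotomic_cosets q t")
    case True
    then obtain a where a: "a < ?N" "C = coset q t a" by (auto simp: cyclotomic_cosets_eq)
    have "lift_exp ?N b \<in> {2..m} \<longleftrightarrow> b \<noteq> 0 \<and> b \<noteq> 1 mod ?N \<and> b \<le> m" if "b \<in> C" for b
    proof -
      have "b < ?N" using that a coset_subset by blast
      \<comment> \<open>If \<open>?N = 1\<close>, that is \<open>q ^ t = 2\<close>, then
        \<open>1 mod ?N\<close> is 0.\<close>
      then show ?thesis using assms by (cases "?N = 1") (auto simp: lift_exp_def)
    qed
    then have "(\<forall>b\<in>C. lift_exp ?N b \<in> {2..m}) \<longleftrightarrow> (\<forall>b\<in>C. b \<noteq> 0 \<and> b \<noteq> 1 mod ?N \<and> b \<le> m)"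
      by (intro ball_cong refl)
    also have "\<dots> \<longleftrightarrow> 0 \<notin> C \<and> 1 mod ?N \<notin> C \<and> Max C \<le> m"
      using Max_coset(2)[OF a(1), of m] unfolding a(2) by metis
    finally show ?thesis using True by simp
  qed simp
qed

lemma power_minus_one_le:
  assumes "q \<ge> (2::nat)" "t \<ge> 1" "q ^ t \<noteq> 2"
  shows "q ^ (t - 1) \<le> q ^ t - 2"
proof -
  obtain u where u: "t = Suc u" using assms(2) by (cases t) auto
  show ?thesis
  proof (cases "q = 2")
    case True
    then obtain v where v: "u = Suc v" using assms u by (cases u) auto
    have "q ^ (t - 1) = 2 * 2 ^ v" "q ^ t = 4 * 2 ^ v" "1 \<le> (2::nat) ^ v"
      using True u v by simp_all
    then show ?thesis by linarith
  next
    case False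
    then have "3 * q ^ u \<le> q * q ^ u" using assms by (intro mult_le_mono1) auto
    moreover have "1 \<le> q ^ u" "q ^ (t - 1) = q ^ u" "q ^ t = q * q ^ u" using assms u by simp_all
    ultimately show ?thesis by linarith
  qed
qed

text \<open>Matches the final record, whose family is empty. A nonzero orbit reaches some element
  that is at least \<open>q ^ (t - 1)\<close>; if it were also at most that, the next multiple
  \<open>q ^ t\<close> would reduce to the excluded exponent 1. The class 0 lifts to
  \<open>q ^ t - 1\<close>, which is too large unless \<open>q ^ t = 2\<close>, where it is
  1.\<close>

lemma admissible_empty:
  assumes "q \<ge> 2" "t \<ge> 1"
  shows "admissible q t (q ^ (t - 1)) = {}"
proof (cases "q ^ t = 2")
  case True
  then have "\<And>a. a < q ^ t - 1 \<Longrightarrow> a = 0" by simp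
  then show ?thesis using True by (auto simp: admissible_def lift_exp_def intro!: exI[of _ 0])
next
  case False
  let ?N = "q ^ t - 1"
  have le: "q ^ (t - 1) \<le> q ^ t - 2" using power_minus_one_le assms False by blast
  have "q ^ 1 \<le> q ^ t" using assms by (intro power_increasing) auto
  then have n: "q ^ t > 2" using assms False by simp
  have False if a: "a < ?N" "\<forall>i. lift_exp ?N (q ^ i * a mod ?N) \<in> {2..q ^ (t - 1)}" for a
  proof (cases "a = 0")
    case True
    then show False using a(2) le n by (auto simp: lift_exp_def)
  next
    case a0: False
    then obtain j where j: "q ^ (t - 1) \<le> q ^ j * a" "q ^ j * a < ?N"
      using coset_large_element assms a(1) by blast
    then have "q ^ j * a = q ^ (t - 1)"
      using a(2)[rule_format, of j] assms a0 by (simp add: lift_exp_def)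
    then have "q ^ Suc j * a = q ^ t"
      using assms(2) by (metis mult.assoc power_Suc Suc_diff_1 less_eq_Suc_le One_nat_def)
    moreover have "q ^ t mod ?N = 1"
      using power_mult_cong_1[of q t 1 1] n assms by simp
    ultimately have "lift_exp ?N (q ^ Suc j * a mod ?N) = 1" by (simp add: lift_exp_def)
    then show False using a(2)[rule_format, of "Suc j"] by simp
  qed
  then show ?thesis unfolding admissible_def by blast
qed

text \<open>In a loop record \<open>s\<close> is chosen so that \<open>q ^ t - k - s\<close> is the
  current maximum, and \<open>coset_large_element\<close> puts this maximum at
  \<open>q ^ (t - 1)\<close> or above. The resulting bound on \<open>s\<close> later leaves room for
  the trace polynomial in the parity check at the origin.\<close>

lemma recorded_admissible:
  assumes rec: "(U, s, R) \<in> recorded q t k"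
    and q: "q \<ge> 2" and t: "t \<ge> 1" and k: "1 \<le> k" "k \<le> q ^ t - q ^ (t - 1)"
  shows "U \<subseteq> cyclotomic_cosets q t" "R = s + (\<Sum>C\<in>U. card C)"
    "s + k + q ^ (t - 1) \<le> q ^ t" "\<Union>U = admissible q t (q ^ t - k - s)"
proof -
  have "q ^ (t - 1) \<le> q ^ t" using q by (intro power_increasing) auto
  then have kn: "k + q ^ (t - 1) \<le> q ^ t" using k by simp
  have "U \<subseteq> cyclotomic_cosets q t \<and> R = s + (\<Sum>C\<in>U. card C) \<and>
    s + k + q ^ (t - 1) \<le> q ^ t \<and> \<Union>U = admissible q t (q ^ t - k - s)"
    using rec
  proof cases
    case first
    let ?N = "q ^ t - 1"
    \<comment> \<open>Here \<open>s = 0\<close> and \<open>k = 1\<close>, so the threshold is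
      \<open>?N\<close> itself. The class 0, lifted to \<open>?N\<close>, is now allowed, as the
      presence of \<open>{0}\<close> in this record requires.\<close>
    have "\<Union>U = admissible q t ?N" unfolding admissible_def
    proof (rule Union_cosets_eq)
      fix C
      show "C \<in> U \<longleftrightarrow> C \<in> cyclotomic_cosets q t \<and> (\<forall>b\<in>C. lift_exp ?N b \<in> {2..?N})"
      proof (cases "C \<in> cyclotomic_cosets q t")
        case True
        then obtain a where a: "a < ?N" "C = coset q t a" by (auto simp: cyclotomic_cosets_eq)
        have "lift_exp ?N b \<in> {2..?N} \<longleftrightarrow> b \<noteq> 1 mod ?N" if "b \<in> C" for b
        proof -
          have "b < ?N" using that a coset_subset by blast
          then show ?thesis by (cases "?N = 1") (auto simp: lift_exp_def)
        qed
        then show ?thesis using first True by (auto simp: initial_cosets_def)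
      qed (use first in \<open>simp add: initial_cosets_def\<close>)
    qed
    then show ?thesis using first kn by (auto simp: initial_cosets_def)
  next
    case loop
    let ?\<beta> = "Max (Max ` U)"
    obtain m where m: "m \<le> q ^ t - k"
      "U = {C \<in> cyclotomic_cosets q t. 0 \<notin> C \<and> 1 mod (q ^ t - 1) \<notin> C \<and> Max C \<le> m}"
      using loop_cosets_eq loop k by blast
    have fin: "finite U" unfolding m(2) cyclotomic_cosets_eq by simp
    then have "?\<beta> \<in> Max ` U" using loop by (intro Max_in) auto
    then obtain C where C: "C \<in> U" "?\<beta> = Max C" by blast
    then obtain a where a: "a < q ^ t - 1" "C = coset q t a"
      using m(2) by (auto simp: cyclotomic_cosets_eq)
    have "?\<beta> \<in> C" using C a Max_coset by metis
    then have \<beta>2: "?\<beta> \<le> q ^ t - 2" using a coset_subset by fastforce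
    have \<beta>m: "?\<beta> \<le> m" using C m(2) by auto
    have "0 < a" using C m(2) a coset_self by (cases "a = 0") auto
    then obtain j where j: "q ^ (t - 1) \<le> q ^ j * a" "q ^ j * a < q ^ t - 1"
      using coset_large_element q a(1) by blast
    then have "q ^ j * a mod (q ^ t - 1) = q ^ j * a" by simp
    then have "q ^ j * a \<in> C" unfolding a(2) coset_def by (metis (mono_tags, lifting) CollectI)
    then have "q ^ (t - 1) \<le> ?\<beta>" using C a Max_coset(2) j by (metis order_refl order_trans)
    moreover have "U = {C \<in> cyclotomic_cosets q t. 0 \<notin> C \<and> 1 mod (q ^ t - 1) \<notin> C \<and> Max C \<le> ?\<beta>}"
      (is "U = ?U'")
    proof
      show "U \<subseteq> ?U'" using m(2) fin by auto
      show "?U' \<subseteq> U" using m(2) \<beta>m by auto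
    qed
    then have "\<Union>U = admissible q t ?\<beta>" using Union_cosets_admissible[OF \<beta>2] by simp
    moreover have "q ^ t - k - s = ?\<beta>" using loop \<beta>m m(1) by simp
    moreover have "s + k + q ^ (t - 1) \<le> q ^ t"
      using \<open>q ^ (t - 1) \<le> ?\<beta>\<close> \<open>s = q ^ t - k - ?\<beta>\<close> \<beta>m m(1) kn by linarith
    moreover have "U \<subseteq> cyclotomic_cosets q t" unfolding m(2) by blast
    moreover have "R = s + (\<Sum>C\<in>U. card C)" using loop by blast
    ultimately show ?thesis by (intro conjI) simp_all
  next
    case final
    then have "q ^ t - k - s = q ^ (t - 1)" using kn by simp
    then show ?thesis using final kn admissible_empty[OF q t] by simp
  qed
  then show "U \<subseteq> cyclotomic_cosets q t" "R = s + (\<Sum>C\<in>U. card C)"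
    "s + k + q ^ (t - 1) \<le> q ^ t" "\<Union>U = admissible q t (q ^ t - k - s)" by blast+
qed

lemma inj_on_lift_exp: "inj_on (lift_exp N) {..<N}"
  by (auto simp: inj_on_def lift_exp_def split: if_splits)

lemma lift_exp_bounds: "a < N \<Longrightarrow> 0 < lift_exp N a \<and> lift_exp N a \<le> N"
  by (simp add: lift_exp_def)

lemma ex_lift_exp:
  assumes "0 < j" "j \<le> N"
  obtains a where "a < N" "lift_exp N a = j"
  using assms that[of "if j = N then 0 else j"] by (auto simp: lift_exp_def)

lemma admissible_closed: "a \<in> admissible q t m \<Longrightarrow> q * a mod (q ^ t - 1) \<in> admissible q t m"
proof -
  assume a: "a \<in> admissible q t m"
  then have "q ^ i * (q * a mod (q ^ t - 1)) mod (q ^ t - 1) = q ^ Suc i * a mod (q ^ t - 1)" for i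
    by (simp add: mod_mult_right_eq mult_ac)
  with a show ?thesis unfolding admissible_def mem_Collect_eq by (metis mod_less_divisor not_less0 zero_less_iff_neq_zero)
qed

section \<open>Finite fields, Reed--Solomon codes and base-field-valued polynomials\<close>

lemma CARD_finite_field_ge_2: "CARD('a::finite_field) \<ge> 2"
proof -
  have "card {0, 1 :: 'a} \<le> CARD('a)" by (intro card_mono) auto
  then show ?thesis by simp
qed

text \<open>Stated for an indexed family because the bases below are indexed by the nodes;
  independence of the family also makes it injective.\<close>

lemma (in vector_space) dim_eq_card_basis_family:
  assumes J: "finite J" and e: "\<And>i. i \<in> J \<Longrightarrow> e i \<in> X"
    and gen: "\<And>x. x \<in> X \<Longrightarrow> \<exists>c. x = (\<Sum>i\<in>J. scale (c i) (e i))"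
    and ind: "\<And>a i. (\<Sum>i\<in>J. scale (a i) (e i)) = 0 \<Longrightarrow> i \<in> J \<Longrightarrow> a i = 0"
  shows "dim X = card J"
proof -
  have inj: "inj_on e J"
  proof (rule inj_onI, rule ccontr)
    fix i j assume ij: "i \<in> J" "j \<in> J" "e i = e j" "i \<noteq> j"
    \<comment> \<open>Two equal members would give the nontrivial relation
      \<open>e i - e j = 0\<close>.\<close>
    let ?a = "\<lambda>l. (if l = i then 1 else if l = j then - 1 else 0 :: 'a)"
    have "(\<Sum>l\<in>J. scale (?a l) (e l)) = (\<Sum>l\<in>{i, j}. scale (?a l) (e l))"
      using ij J by (intro sum.mono_neutral_right) auto
    also have "\<dots> = 0" using ij by simp
    finally have "?a i = 0" using ij(1) by (rule ind[of ?a])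
    then show False by simp
  qed
  have "dim X = card (e ` J)"
  proof (rule basis_card_eq_dim[symmetric])
    show "X \<subseteq> span (e ` J)"
    proof
      fix x assume "x \<in> X"
      then obtain c where "x = (\<Sum>i\<in>J. scale (c i) (e i))" using gen by blast
      then show "x \<in> span (e ` J)" by (simp only:) (intro span_sum span_scale span_base imageI)
    qed
    show "independent (e ` J)"
    proof (rule independent_if_scalars_zero)
      fix f x assume "(\<Sum>x\<in>e ` J. scale (f x) (x)) = 0" "x \<in> e ` J"
      then show "f x = 0" using ind[of "\<lambda>i. f (e i)"] inj by (auto simp: sum.reindex)
    qed (use J in simp)
  qed (use e in blast)
  then show ?thesis using inj by (simp add: card_image)
qed

text \<open>Combine the relations with the coefficients of the polynomial that vanishes at every
  \<open>z a\<close> except \<open>z b\<close>. Its degree is below \<open>card A\<close>, and only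
  the term of \<open>c b\<close> survives.\<close>

lemma vandermonde_injective:
  fixes c z :: "'a \<Rightarrow> 'k::field"
  assumes A: "finite A" "inj_on z A"
    and zero: "\<And>i. i < card A \<Longrightarrow> (\<Sum>a\<in>A. c a * z a ^ i) = 0"
    and b: "b \<in> A"
  shows "c b = 0"
proof -
  define p where "p = (\<Prod>a\<in>A - {b}. [:- z a, 1:])"
  have "degree p = card (A - {b})" unfolding p_def
    by (subst degree_prod_eq_sum_degree) auto
  then have deg: "degree p < card A" using A b by (metis card_Diff1_less)
  have "(\<Sum>a\<in>A. c a * poly p (z a)) = (\<Sum>a\<in>A. \<Sum>i\<le>degree p. coeff p i * (c a * z a ^ i))"
    by (simp add: poly_altdef sum_distrib_left mult_ac)
  also have "\<dots> = (\<Sum>i\<le>degree p. coeff p i * (\<Sum>a\<in>A. c a * z a ^ i))"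
    by (subst sum.swap) (simp add: sum_distrib_left)
  also have "\<dots> = 0" using zero deg by (intro sum.neutral) auto
  finally have "(\<Sum>a\<in>A. c a * poly p (z a)) = 0" .
  moreover have "(\<Sum>a\<in>A. c a * poly p (z a)) = (\<Sum>a\<in>{b}. c a * poly p (z a))"
    using A b by (intro sum.mono_neutral_right) (auto simp: p_def poly_prod)
  moreover have "poly p (z b) \<noteq> 0"
    using A b by (auto simp: p_def poly_prod inj_on_def)
  ultimately show ?thesis by simp
qed

section \<open>Power sums and powers of a primitive element\<close>

lemma finite_field_power_card_minus_1:
  "x ^ (CARD('f) - 1) = 1" if "x \<noteq> 0" for x :: "'f::finite_field"
proof -
  have "x * x ^ (CARD('f) - 1) = x * 1"
    using finite_field_power_card_eq_same[of x]
    by (metis CARD_finite_field_ge_2 Suc_1 Suc_le_D diff_Suc_1 mult.right_neutral power_Suc)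
  then show ?thesis using that by simp
qed

text \<open>For \<open>j > 0\<close>, the polynomial \<open>x ^ j - 1\<close> has too few roots to
  vanish on all nonzero elements; scaling by some \<open>y\<close> with
  \<open>y ^ j \<noteq> 1\<close> permutes the field but multiplies the sum by
  \<open>y ^ j\<close>.\<close>

lemma sum_power_finite_field:
  assumes "j < CARD('f) - 1"
  shows "(\<Sum>x\<in>UNIV. x ^ j) = (0 :: 'f::finite_field)"
proof (cases "j = 0")
  case True
  \<comment> \<open>With \<open>0 ^ 0 = 1\<close> the sum is the field size as a field element;
    translation by 1 shows that it vanishes.\<close>
  have "(\<Sum>x\<in>UNIV. x + 1) = (\<Sum>x\<in>UNIV. x :: 'f)"
    by (rule sum.reindex_bij_witness[of _ "\<lambda>x. x - 1" "\<lambda>x. x + 1"]) auto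
  then have "of_nat CARD('f) = (0 :: 'f)" by (simp add: sum.distrib)
  then show ?thesis using True by simp
next
  case False
  have "\<exists>y :: 'f. y \<noteq> 0 \<and> y ^ j \<noteq> 1"
  proof (rule ccontr)
    assume *: "\<not> ?thesis"
    let ?P = "monom 1 j - 1 :: 'f poly"
    have "coeff ?P j = 1" using False by simp
    then have "?P \<noteq> 0" by (metis coeff_0 zero_neq_one)
    moreover have "degree ?P \<le> j" by (intro degree_diff_le) (auto simp: degree_monom_eq)
    ultimately have "card {x. poly ?P x = 0} \<le> j"
      using card_poly_roots_bound[of ?P] by linarith
    moreover have "card (UNIV - {0::'f}) \<le> card {x. poly ?P x = 0}"
      using * by (intro card_mono) (auto simp: poly_monom)
    ultimately show False using assms by (simp add: card_Diff_singleton)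
  qed
  then obtain y :: 'f where y: "y \<noteq> 0" "y ^ j \<noteq> 1" by blast
  have "(\<Sum>x\<in>UNIV. (y * x) ^ j) = (\<Sum>x\<in>UNIV. x ^ j)"
    by (rule sum.reindex_bij_witness[of _ "\<lambda>x. x / y" "\<lambda>x. y * x"]) (use y in auto)
  then have "y ^ j * (\<Sum>x\<in>UNIV. x ^ j) = 1 * (\<Sum>x\<in>UNIV. x ^ j)"
    by (simp add: power_mult_distrib sum_distrib_left)
  then show ?thesis using y by (metis mult_right_cancel)
qed

lemma sum_poly_finite_field:
  fixes p :: "'f::finite_field poly"
  assumes "degree p < CARD('f) - 1"
  shows "(\<Sum>x\<in>UNIV. poly p x) = 0"
proof -
  have "(\<Sum>x\<in>UNIV. poly p x) = (\<Sum>i\<le>degree p. coeff p i * (\<Sum>x\<in>UNIV. x ^ i))"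
    by (simp add: poly_altdef sum_distrib_left) (rule sum.swap)
  also have "\<dots> = 0" using assms by (intro sum.neutral) (auto simp: sum_power_finite_field)
  finally show ?thesis .
qed

text \<open>If \<open>\<omega> ^ j = 1\<close> with \<open>0 < j < n - 1\<close>, the powers of
  \<open>\<omega>\<close> would take at most \<open>j\<close> values and could not cover all nonzero
  elements.\<close>

lemma inj_on_primitive_power:
  fixes \<omega> :: "'f::finite_field"
  assumes "primitive_element \<omega>"
  shows "inj_on (\<lambda>i. \<omega> ^ i) {..<CARD('f) - 1}"
proof -
  have w0: "\<omega> \<noteq> 0" using assms by (simp add: primitive_element_def)
  have ne: "\<omega> ^ j \<noteq> 1" if j: "0 < j" "j < CARD('f) - 1" for j
  proof
    assume 1: "\<omega> ^ j = 1"
    have "UNIV - {0} \<subseteq> (\<lambda>i. \<omega> ^ i) ` {..<j}"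
    proof
      fix x :: 'f assume "x \<in> UNIV - {0}"
      then obtain i where "x = \<omega> ^ i" using assms by (auto simp: primitive_element_def)
      also have "\<dots> = \<omega> ^ (j * (i div j) + i mod j)" by simp
      also have "\<dots> = \<omega> ^ (i mod j)" unfolding power_add power_mult 1 by simp
      finally show "x \<in> (\<lambda>i. \<omega> ^ i) ` {..<j}" using j by auto
    qed
    then have "card (UNIV - {0::'f}) \<le> card {..<j}" by (meson surj_card_le finite_lessThan)
    then show False using j by (simp add: card_Diff_singleton)
  qed
  show ?thesis
  proof (rule linorder_inj_onI')
    fix i j assume ij: "i \<in> {..<CARD('f) - 1}" "j \<in> {..<CARD('f) - 1}" "i < j"
    have "\<omega> ^ j = \<omega> ^ i * \<omega> ^ (j - i)" using ij by (simp flip: power_add)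
    moreover have "\<omega> ^ (j - i) \<noteq> 1" using ij by (intro ne) auto
    ultimately show "\<omega> ^ i \<noteq> \<omega> ^ j" using w0 by auto
  qed
qed

text \<open>It suffices that the downloads determine the symbol at 0: the decoder may then choose
  any codeword consistent with them.\<close>

lemma repairs_originI:
  assumes "D \<subseteq> UNIV - {0}"
    and eq: "\<And>v w. v \<in> RS k \<Longrightarrow> w \<in> RS k \<Longrightarrow> \<forall>\<beta>\<in>D. \<phi> \<beta> (v $ \<beta>) = \<phi> \<beta> (w $ \<beta>) \<Longrightarrow> v $ 0 = w $ 0"
  shows "repairs_origin k \<phi> D"
proof -
  let ?data = "\<lambda>v. \<lambda>\<beta>\<in>D. \<phi> \<beta> (v $ \<beta>)"
  define \<rho> where "\<rho> f = (SOME w. w \<in> RS k \<and> ?data w = f) $ 0" for f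
  have "\<rho> (?data v) = v $ 0" if v: "v \<in> RS k" for v
  proof -
    define w where "w = (SOME w. w \<in> RS k \<and> ?data w = ?data v)"
    have w: "w \<in> RS k \<and> ?data w = ?data v"
      unfolding w_def by (rule someI[of _ v]) (use v in simp)
    then have "\<forall>\<beta>\<in>D. \<phi> \<beta> (w $ \<beta>) = \<phi> \<beta> (v $ \<beta>)"
      using fun_cong[of "?data w" "?data v"] by (metis (no_types, lifting) restrict_apply')
    then show ?thesis using eq w v unfolding \<rho>_def w_def by blast
  qed
  then show ?thesis using assms(1) unfolding repairs_origin_def by blast
qed

section \<open>The polynomials \<open>g\<close> and \<open>h\<close> and the conditions defining
  \<open>V_space\<close>\<close>

lemma
  fixes S :: "'f::finite_field set"
  shows poly_g_poly_eq_0_iff: "poly (g_poly S) \<alpha> = 0 \<longleftrightarrow> \<alpha> \<in> S"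
    and g_poly_nonzero: "g_poly S \<noteq> 0"
    and degree_g_poly: "degree (g_poly S) = card S"
proof -
  show "poly (g_poly S) \<alpha> = 0 \<longleftrightarrow> \<alpha> \<in> S" by (auto simp: g_poly_def poly_prod)
  show "g_poly S \<noteq> 0" by (simp add: g_poly_def)
  show "degree (g_poly S) = card S"
    unfolding g_poly_def by (subst degree_prod_eq_sum_degree) auto
qed

lemma h_poly_mult_x: "h_poly S ([:0, 1:] * T) = g_poly S * T"
proof -
  have "g_poly S * ([:0, 1:] * T) = [:0, 1:] * (g_poly S * T)" by (simp add: mult_ac)
  then show ?thesis unfolding h_poly_def by (metis nonzero_mult_div_cancel_left pCons_eq_0_iff one_neq_zero)
qed

text \<open>Because \<open>g(0)\<close> is nonzero, divisibility by \<open>x\<close> forces the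
  constant term of \<open>T\<close> to vanish, and \<open>h(0) = 0\<close> then forces the next
  coefficient to vanish. For nonzero \<open>T\<close>, the degree of \<open>h\<close> is
  \<open>card S + degree T - 1\<close>.\<close>

lemma V_space_iff:
  fixes emb :: "'b::finite_field \<Rightarrow> 'f::finite_field"
  assumes "0 \<notin> S" "1 \<le> k" "k + card S < CARD('f)"
  shows "T \<in> V_space emb k S \<longleftrightarrow> range (poly T) \<subseteq> range emb \<and>
    degree T \<le> CARD('f) - k - card S \<and> coeff T 0 = 0 \<and> coeff T 1 = 0"
proof (cases "coeff T 0 = 0")
  case True
  then obtain T1 where T: "T = [:0, 1:] * T1"
    by (cases T) auto
  have h: "h_poly S T = g_poly S * T1" unfolding T by (rule h_poly_mult_x)
  have "poly (g_poly S * T1) 0 = 0 \<longleftrightarrow> coeff T 1 = 0"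
    using assms(1) poly_g_poly_eq_0_iff[of S 0] by (simp only: T poly_mult) (simp add: poly_0_coeff_0)
  moreover have "degree (g_poly S * T1) \<le> CARD('f) - k - 1 \<longleftrightarrow> degree T \<le> CARD('f) - k - card S"
  proof (cases "T1 = 0")
    case False
    then have "degree (g_poly S * T1) = card S + degree T1" "degree T = Suc (degree T1)"
      using degree_mult_eq[OF g_poly_nonzero False, of S] by (simp_all add: T degree_g_poly)
    then show ?thesis using assms by auto
  qed (simp add: T)
  moreover have "[:0, 1:] dvd g_poly S * T" unfolding T by (metis dvd_mult dvd_triv_left)
  ultimately show ?thesis unfolding V_space_def by (auto simp: h True)
next
  case False
  then have "poly (g_poly S * T) 0 \<noteq> 0"
    using assms(1) poly_g_poly_eq_0_iff[of S 0] by (simp only: poly_mult) (simp add: poly_0_coeff_0)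
  then have "\<not> [:0, 1:] dvd g_poly S * T" using dvd_iff_poly_eq_0[of 0 "g_poly S * T"] by auto
  then show ?thesis using False by (simp add: V_space_def)
qed

text \<open>At \<open>\<alpha> = 0\<close> both sides are 0: \<open>h\<close> vanishes there, and
  division by 0 yields 0.\<close>

lemma poly_h_poly:
  fixes emb :: "'b::finite_field \<Rightarrow> 'f::finite_field"
  assumes "T \<in> V_space emb k S"
  shows "poly (h_poly S T) \<alpha> = poly (g_poly S) \<alpha> * poly T \<alpha> / \<alpha>"
proof (cases "\<alpha> = 0")
  case False
  have "[:0, 1:] dvd g_poly S * T" using assms by (simp add: V_space_def)
  then have "g_poly S * T = [:0, 1:] * h_poly S T" unfolding h_poly_def by (rule dvd_mult_div_cancel[symmetric])
  then have "poly (g_poly S * T) \<alpha> = poly ([:0, 1:] * h_poly S T) \<alpha>" by simp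
  then show ?thesis using False by (simp add: field_simps)
qed (use assms in \<open>simp add: V_space_def\<close>)

section \<open>Base-field-valued polynomials and the Frobenius map\<close>

locale field_extension =
  fixes emb :: "'b::finite_field \<Rightarrow> 'f::finite_field" and t :: nat
  assumes emb: "field_embedding emb" and card_F: "CARD('f) = CARD('b) ^ t"
begin

lemma t_pos: "t > 0"
  using CARD_finite_field_ge_2[where 'a='f] card_F by (cases t) auto

lemma emb_add: "emb (x + y) = emb x + emb y"
  and emb_mult: "emb (x * y) = emb x * emb y"
  and emb_1: "emb 1 = 1"
  and emb_0: "emb 0 = 0"
  and emb_eq_iff: "emb x = emb y \<longleftrightarrow> x = y"
  using emb field_embedding_0[OF emb] field_embedding_inj[OF emb]
  by (auto simp: field_embedding_def inj_def)

lemma emb_sum: "emb (\<Sum>i\<in>A. f i) = (\<Sum>i\<in>A. emb (f i))"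
  by (induction A rule: infinite_finite_induct) (simp_all add: emb_0 emb_add)

lemma emb_the_inv: "y \<in> range emb \<Longrightarrow> emb (the_inv emb y) = y"
  by (rule f_the_inv_into_f[OF field_embedding_inj[OF emb]])

lemma emb_power_card: "emb b ^ CARD('b) = emb b"
  by (simp add: finite_field_power_card_eq_same flip: field_embedding_power[OF emb])

lemma emb_power_card_power: "emb b ^ CARD('b) ^ i = emb b"
  by (induction i) (simp_all add: power_mult emb_power_card)

lemma sum_power_card: "(\<Sum>i\<in>A. f i) ^ CARD('b) = (\<Sum>i\<in>A. f i ^ CARD('b))" for f :: "'a \<Rightarrow> 'f"
  by (induction A rule: infinite_finite_induct)
    (simp_all add: power_card_add[OF emb] power_0_left)

lemma power_mod_N: "x ^ (a mod (CARD('f) - 1)) = x ^ a" if "x \<noteq> 0" for x :: 'f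
proof -
  have "x ^ a = x ^ ((CARD('f) - 1) * (a div (CARD('f) - 1)) + a mod (CARD('f) - 1))" by simp
  also have "\<dots> = x ^ (a mod (CARD('f) - 1))"
    unfolding power_add power_mult finite_field_power_card_minus_1[OF that] by simp
  finally show ?thesis by simp
qed

lemma power_lift_exp: "x ^ lift_exp (CARD('f) - 1) a = x ^ a" if "x \<noteq> 0" for x :: 'f
  using finite_field_power_card_minus_1[OF that] by (simp add: lift_exp_def)

text \<open>The inverse is multiplication by \<open>q ^ (t - 1)\<close>, since \<open>q ^ t\<close>
  is 1 modulo \<open>n - 1\<close>.\<close>

lemma inj_on_mult_mod: "inj_on (\<lambda>a. CARD('b) * a mod (CARD('f) - 1)) {..<(CARD('f) - 1)}"
proof (rule inj_on_inverseI)
  fix a assume "a \<in> {..<(CARD('f) - 1)}"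
  moreover have "CARD('b) ^ (t - 1) * (CARD('b) * a mod (CARD('f) - 1)) mod (CARD('f) - 1) = CARD('b) ^ (t * 1) * a mod (CARD('f) - 1)"
    using t_pos by (simp add: mod_mult_right_eq mult.assoc[symmetric] power_eq_if[of "CARD('b)" t] mult.commute)
  ultimately show "CARD('b) ^ (t - 1) * (CARD('b) * a mod (CARD('f) - 1)) mod (CARD('f) - 1) = a"
    using power_mult_cong_1[of "CARD('b)" t 1 a] by (simp add: card_F)
qed

text \<open>Lifting exponents to \<open>{1..n - 1}\<close> removes the constant term: the class 0
  stands for \<open>x ^ (n - 1)\<close>, which vanishes at 0.\<close>

definition expo_poly :: "nat set \<Rightarrow> (nat \<Rightarrow> 'f) \<Rightarrow> 'f poly" where
  "expo_poly A c = (\<Sum>a\<in>A. monom (c a) (lift_exp (CARD('f) - 1) a))"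

lemma poly_expo_poly: "poly (expo_poly A c) x = (\<Sum>a\<in>A. c a * x ^ lift_exp (CARD('f) - 1) a)"
  by (simp add: expo_poly_def poly_sum poly_monom)

lemma degree_expo_poly:
  assumes "A \<subseteq> {..<(CARD('f) - 1)}"
  shows "degree (expo_poly A c) \<le> (CARD('f) - 1)"
  unfolding expo_poly_def
proof (rule degree_sum_le)
  show "finite A" using assms finite_subset by blast
  show "degree (monom (c a) (lift_exp (CARD('f) - 1) a)) \<le> (CARD('f) - 1)" if "a \<in> A" for a
    using degree_monom_le[of "c a" "lift_exp (CARD('f) - 1) a"] lift_exp_bounds[of a "CARD('f) - 1"] assms that by force
qed

lemma coeff_expo_poly:
  assumes "A \<subseteq> {..<(CARD('f) - 1)}" "b < (CARD('f) - 1)"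
  shows "coeff (expo_poly A c) (lift_exp (CARD('f) - 1) b) = (if b \<in> A then c b else 0)"
proof -
  have "finite A" using assms finite_subset by blast
  have "coeff (expo_poly A c) (lift_exp (CARD('f) - 1) b) = (\<Sum>a\<in>A. if lift_exp (CARD('f) - 1) a = lift_exp (CARD('f) - 1) b then c a else 0)"
    unfolding expo_poly_def coeff_sum by simp
  also have "\<dots> = (\<Sum>a\<in>A. if a = b then c a else 0)"
    using assms inj_on_lift_exp[of "CARD('f) - 1"] by (intro sum.cong) (auto simp: inj_on_def)
  finally show ?thesis using \<open>finite A\<close> by simp
qed

lemma coeff_expo_poly_0:
  assumes "A \<subseteq> {..<(CARD('f) - 1)}"
  shows "coeff (expo_poly A c) 0 = 0"
  unfolding expo_poly_def coeff_sum
proof (intro sum.neutral ballI)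
  fix a assume "a \<in> A"
  then have "lift_exp (CARD('f) - 1) a \<noteq> 0" using assms lift_exp_bounds by blast
  then show "coeff (monom (c a) (lift_exp (CARD('f) - 1) a)) 0 = 0" by simp
qed

lemma poly_eq_card:
  fixes P Q :: "'f poly"
  assumes "\<And>x. poly P x = poly Q x" "degree P \<le> (CARD('f) - 1)" "degree Q \<le> (CARD('f) - 1)"
  shows "P = Q"
  using assms CARD_finite_field_ge_2[where 'a='f]
  by (intro poly_eqI_degree[of UNIV]) auto

lemma expo_poly_eq_iff:
  assumes "A \<subseteq> {..<(CARD('f) - 1)}"
  shows "expo_poly A c = expo_poly A c' \<longleftrightarrow> (\<forall>a\<in>A. c a = c' a)"
proof
  assume "expo_poly A c = expo_poly A c'"
  then show "\<forall>a\<in>A. c a = c' a" using assms coeff_expo_poly[OF assms] by (metis lessThan_iff subsetD)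
qed (simp add: expo_poly_def)

text \<open>The \<open>q\<close>-th power acts termwise, raising coefficients to the power
  \<open>q\<close> and multiplying exponents by \<open>q\<close>; reduced modulo
  \<open>n - 1\<close>, the new exponents are a permutation of \<open>A\<close>.\<close>

lemma expo_poly_frobenius:
  assumes A: "A \<subseteq> {..<(CARD('f) - 1)}" and closed: "\<And>a. a \<in> A \<Longrightarrow> CARD('b) * a mod (CARD('f) - 1) \<in> A"
  obtains c' where "\<And>a. a \<in> A \<Longrightarrow> c' (CARD('b) * a mod (CARD('f) - 1)) = c a ^ CARD('b)"
    "\<And>x. poly (expo_poly A c') x = poly (expo_poly A c) x ^ CARD('b)"
proof -
  let ?\<sigma> = "\<lambda>a. CARD('b) * a mod (CARD('f) - 1)"
  have inj: "inj_on ?\<sigma> A" using inj_on_mult_mod A by (rule inj_on_subset)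
  define c' where "c' b = c (the_inv_into A ?\<sigma> b) ^ CARD('b)" for b
  have c': "c' (?\<sigma> a) = c a ^ CARD('b)" if "a \<in> A" for a
    unfolding c'_def using the_inv_into_f_f[OF inj that] by simp
  have "finite A" using A finite_subset by blast
  then have bij: "bij_betw ?\<sigma> A A"
    using inj closed by (metis bij_betw_def endo_inj_surj image_subsetI)
  have "poly (expo_poly A c') x = poly (expo_poly A c) x ^ CARD('b)" for x
  proof -
    have "poly (expo_poly A c') x = (\<Sum>a\<in>A. c' (?\<sigma> a) * x ^ lift_exp (CARD('f) - 1) (?\<sigma> a))"
      unfolding poly_expo_poly by (rule sum.reindex_bij_betw[OF bij, symmetric])
    also have "\<dots> = (\<Sum>a\<in>A. (c a * x ^ lift_exp (CARD('f) - 1) a) ^ CARD('b))"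
    proof (rule sum.cong)
      fix a assume a: "a \<in> A"
      have "x ^ lift_exp (CARD('f) - 1) (?\<sigma> a) = (x ^ lift_exp (CARD('f) - 1) a) ^ CARD('b)"
      \<comment> \<open>At 0 both sides vanish because lifted exponents are positive. Elsewhere
        exponents only matter modulo \<open>n - 1\<close>.\<close>
      proof (cases "x = 0")
        case True
        then show ?thesis
          using lift_exp_bounds[of _ "CARD('f) - 1"] a closed A by (auto simp: power_0_left subset_iff)
      next
        case False
        then have "x ^ lift_exp (CARD('f) - 1) (?\<sigma> a) = x ^ (CARD('b) * a)"
          using power_lift_exp power_mod_N by presburger
        also have "\<dots> = (x ^ a) ^ CARD('b)" by (simp add: mult.commute flip: power_mult)
        also have "\<dots> = (x ^ lift_exp (CARD('f) - 1) a) ^ CARD('b)"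
          by (simp only: power_lift_exp[OF False])
        finally show ?thesis .
      qed
      then show "c' (?\<sigma> a) * x ^ lift_exp (CARD('f) - 1) (?\<sigma> a) = (c a * x ^ lift_exp (CARD('f) - 1) a) ^ CARD('b)"
        by (simp only: c'[OF a] power_mult_distrib)
    qed simp
    finally show ?thesis by (simp add: poly_expo_poly sum_power_card)
  qed
  with c' show ?thesis by (rule that)
qed

lemma poly_eq_expo_poly:
  assumes "degree T \<le> (CARD('f) - 1)" "coeff T 0 = 0"
  shows "T = expo_poly {..<(CARD('f) - 1)} (\<lambda>a. coeff T (lift_exp (CARD('f) - 1) a))"
proof (rule poly_eqI)
  fix j
  let ?E = "expo_poly {..<(CARD('f) - 1)} (\<lambda>a. coeff T (lift_exp (CARD('f) - 1) a))"
  consider "j = 0" | "0 < j" "j \<le> (CARD('f) - 1)" | "(CARD('f) - 1) < j" by linarith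
  then show "coeff T j = coeff ?E j"
  proof cases
    case 1
    then show ?thesis using assms coeff_expo_poly_0 by simp
  next
    case 2
    then obtain a where "a < (CARD('f) - 1)" "lift_exp (CARD('f) - 1) a = j" by (rule ex_lift_exp)
    then show ?thesis using coeff_expo_poly[of "{..<(CARD('f) - 1)}" a] by auto
  next
    case 3
    then have "degree T < j" "degree ?E < j"
      using assms degree_expo_poly[OF order_refl] by (meson le_less_trans)+
    then show ?thesis by (simp add: coeff_eq_0)
  qed
qed

lemma admissible_subset: "admissible CARD('b) t m \<subseteq> {..<(CARD('f) - 1)}"
  by (auto simp: admissible_def card_F)

text \<open>For \<open>T\<close> in \<open>V_space\<close>, \<open>T\<close> and the reduction of
  \<open>T ^ q\<close> agree as functions and have degree at most \<open>n - 1\<close>, so they are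
  equal. Comparing coefficients, \<open>c (q * a) = c a ^ q\<close> modulo \<open>n - 1\<close>: a
  nonzero coefficient spreads over its whole orbit, which must then respect the bounds.\<close>

lemma V_space_eq:
  assumes S: "0 \<notin> S" and k: "1 \<le> k" "k + card S < CARD('f)"
  defines "A \<equiv> admissible CARD('b) t (CARD('f) - k - card S)"
  shows "V_space emb k S = {T. range (poly T) \<subseteq> range emb \<and> (\<exists>c. T = expo_poly A c)}"
proof (intro set_eqI iffI)
  let ?m = "CARD('f) - k - card S"
  fix T assume "T \<in> V_space emb k S"
  then have T: "range (poly T) \<subseteq> range emb" "degree T \<le> ?m" "coeff T 0 = 0" "coeff T 1 = 0"
    using V_space_iff[OF assms(1-3), of T emb] by auto
  define c where "c a = coeff T (lift_exp (CARD('f) - 1) a)" for a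
  have "degree T \<le> (CARD('f) - 1)" using T(2) k by linarith
  then have Tc: "T = expo_poly {..<(CARD('f) - 1)} c" unfolding c_def using T(3) by (rule poly_eq_expo_poly)
  obtain c' where c': "\<And>a. a \<in> {..<(CARD('f) - 1)} \<Longrightarrow> c' (CARD('b) * a mod (CARD('f) - 1)) = c a ^ CARD('b)"
    "\<And>x. poly (expo_poly {..<(CARD('f) - 1)} c') x = poly (expo_poly {..<(CARD('f) - 1)} c) x ^ CARD('b)"
    using expo_poly_frobenius[of "{..<(CARD('f) - 1)}" c] by (metis (no_types, lifting) lessThan_iff mod_less_divisor not_less0 order_refl zero_less_iff_neq_zero)
  have "poly (expo_poly {..<(CARD('f) - 1)} c') x = poly (expo_poly {..<(CARD('f) - 1)} c) x" for x
  proof -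
    obtain b where "poly T x = emb b" using T(1) by blast
    then show ?thesis using c'(2)[of x] emb_power_card Tc by simp
  qed
  then have "expo_poly {..<(CARD('f) - 1)} c' = expo_poly {..<(CARD('f) - 1)} c" by (intro poly_eq_card degree_expo_poly) auto
  then have "c' a = c a" if "a < (CARD('f) - 1)" for a using that by (simp add: expo_poly_eq_iff)
  then have step: "c (CARD('b) * a mod (CARD('f) - 1)) = c a ^ CARD('b)" if "a < (CARD('f) - 1)" for a
    using c'(1)[of a] that by (metis gr_implies_not0 lessThan_iff mod_less_divisor zero_less_iff_neq_zero)
  have orbit: "c (CARD('b) ^ i * a mod (CARD('f) - 1)) \<noteq> 0" if "a < (CARD('f) - 1)" "c a \<noteq> 0" for a i
  proof (induction i)
    case (Suc i)
    have "CARD('b) ^ Suc i * a mod (CARD('f) - 1) = CARD('b) * (CARD('b) ^ i * a mod (CARD('f) - 1)) mod (CARD('f) - 1)" by (simp add: mod_mult_right_eq mult.assoc)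
    moreover have "CARD('b) ^ i * a mod (CARD('f) - 1) < (CARD('f) - 1)" using that by simp
    ultimately show ?case using step Suc by simp
  qed (use that in simp)
  have support: "c a = 0" if "a \<in> {..<(CARD('f) - 1)} - A" for a
  proof (rule ccontr)
    assume "c a \<noteq> 0"
    have "lift_exp (CARD('f) - 1) (CARD('b) ^ i * a mod (CARD('f) - 1)) \<in> {2..?m}" for i
    proof -
      have "coeff T (lift_exp (CARD('f) - 1) (CARD('b) ^ i * a mod (CARD('f) - 1))) \<noteq> 0"
        using orbit[of a i] that \<open>c a \<noteq> 0\<close> by (simp add: c_def)
      moreover from this have "lift_exp (CARD('f) - 1) (CARD('b) ^ i * a mod (CARD('f) - 1)) \<noteq> 0" "lift_exp (CARD('f) - 1) (CARD('b) ^ i * a mod (CARD('f) - 1)) \<noteq> 1"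
        using T(3,4) by metis+
      ultimately show ?thesis using T(2) le_degree[of T "lift_exp (CARD('f) - 1) (CARD('b) ^ i * a mod (CARD('f) - 1))"] by simp
    qed
    then have "a \<in> A" using that by (simp add: A_def admissible_def card_F)
    then show False using that by blast
  qed
  have "T = expo_poly A c" unfolding Tc unfolding expo_poly_def
    using support admissible_subset by (intro sum.mono_neutral_right) (auto simp: A_def)
  then show "T \<in> {T. range (poly T) \<subseteq> range emb \<and> (\<exists>c. T = expo_poly A c)}" using T(1) by blast
next
  let ?m = "CARD('f) - k - card S"
  fix T assume "T \<in> {T. range (poly T) \<subseteq> range emb \<and> (\<exists>c. T = expo_poly A c)}"
  then obtain c where T: "range (poly T) \<subseteq> range emb" "T = expo_poly A c" by blast
  have lift: "2 \<le> lift_exp (CARD('f) - 1) a" "lift_exp (CARD('f) - 1) a \<le> ?m" if "a \<in> A" for a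
  proof -
    have "lift_exp (CARD('f) - 1) (CARD('b) ^ 0 * a mod (CARD('f) - 1)) \<in> {2..?m}" "a < (CARD('f) - 1)"
      using that unfolding A_def admissible_def mem_Collect_eq card_F by blast+
    then show "2 \<le> lift_exp (CARD('f) - 1) a" "lift_exp (CARD('f) - 1) a \<le> ?m" by auto
  qed
  have "finite A" using admissible_subset finite_subset unfolding A_def by blast
  have "degree T \<le> ?m" unfolding T expo_poly_def
  proof (rule degree_sum_le[OF \<open>finite A\<close>])
    show "degree (monom (c a) (lift_exp (CARD('f) - 1) a)) \<le> ?m" if "a \<in> A" for a
      using lift[OF that] degree_monom_le order_trans by blast
  qed
  moreover have "coeff T i = 0" if "i < 2" for i
    unfolding T expo_poly_def coeff_sum using that lift by (intro sum.neutral) fastforce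
  ultimately show "T \<in> V_space emb k S" using V_space_iff[OF assms(1-3), of T emb] T(1) by simp
qed

text \<open>At \<open>\<omega> powi (r + int i)\<close> the exponent \<open>a\<close> contributes
  \<open>c a * (\<omega> powi r) ^ a * (\<omega> ^ a) ^ i\<close>. This is a Vandermonde system with
  distinct nodes \<open>\<omega> ^ a\<close>, the shift by \<open>r\<close> being absorbed into the
  coefficients.\<close>

lemma expo_poly_determined:
  fixes \<omega> :: 'f
  assumes \<omega>: "primitive_element \<omega>" and A: "A \<subseteq> {..<(CARD('f) - 1)}"
    and zero: "\<And>i. i < card A \<Longrightarrow> poly (expo_poly A c) (\<omega> powi (r + int i)) = 0" and a: "a \<in> A"
  shows "c a = 0"
proof -
  have w0: "\<omega> \<noteq> 0" using \<omega> by (simp add: primitive_element_def)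
  have "c a * (\<omega> powi r) ^ a = 0"
  proof (rule vandermonde_injective[of A "\<lambda>a. \<omega> ^ a"])
    show "finite A" using A finite_subset by blast
    show "inj_on (\<lambda>a. \<omega> ^ a) A" using inj_on_primitive_power[OF \<omega>] A by (rule inj_on_subset)
    show "(\<Sum>a\<in>A. c a * (\<omega> powi r) ^ a * (\<omega> ^ a) ^ i) = 0" if "i < card A" for i
    proof -
      have "(\<omega> powi (r + int i)) ^ lift_exp (CARD('f) - 1) a = (\<omega> powi r) ^ a * (\<omega> ^ a) ^ i" for a
      proof -
        have "(\<omega> powi (r + int i)) ^ lift_exp (CARD('f) - 1) a = (\<omega> powi (r + int i)) ^ a"
          using w0 by (intro power_lift_exp) simp
        also have "\<dots> = (\<omega> powi r) ^ a * (\<omega> ^ i) ^ a"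
          using w0 by (simp add: power_int_add power_mult_distrib)
        finally show ?thesis by (simp add: mult.commute flip: power_mult)
      qed
      then show ?thesis using zero[OF that] by (simp add: poly_expo_poly mult.assoc)
    qed
  qed (rule a)
  then show ?thesis using w0 by simp
qed

lemma expo_poly_diff: "expo_poly A c - expo_poly A c' = expo_poly A (\<lambda>a. c a - c' a)"
  by (simp add: expo_poly_def diff_monom flip: sum_subtractf)

lemma expo_poly_agree:
  fixes \<omega> :: 'f
  assumes \<omega>: "primitive_element \<omega>" and A: "A \<subseteq> {..<(CARD('f) - 1)}"
    and eq: "\<And>i. i < card A \<Longrightarrow>
      poly (expo_poly A c) (\<omega> powi (r + int i)) = poly (expo_poly A c') (\<omega> powi (r + int i))"
  shows "expo_poly A c = expo_poly A c'"
proof -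
  have "c a - c' a = 0" if "a \<in> A" for a
  proof (rule expo_poly_determined[OF \<omega> A _ that, where r = r])
    show "poly (expo_poly A (\<lambda>a. c a - c' a)) (\<omega> powi (r + int i)) = 0" if "i < card A" for i
      using eq[OF that] by (simp flip: expo_poly_diff)
  qed
  then show ?thesis by (simp add: expo_poly_eq_iff[OF A])
qed

text \<open>
  If a polynomial \<open>T\<close> takes base-field values at \<open>card A\<close> consecutive powers, then it agrees
  there with \<open>T ^ q\<close>, whose reduction has exponents in \<open>A\<close> as well; so \<open>T ^ q = T\<close> as functions
  and \<open>T\<close> takes base-field values everywhere.
\<close>

lemma base_field_interpolation:
  fixes \<omega> :: 'f and y :: "nat \<Rightarrow> 'b"
  assumes \<omega>: "primitive_element \<omega>" and A: "A \<subseteq> {..<(CARD('f) - 1)}"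
    and closed: "\<And>a. a \<in> A \<Longrightarrow> CARD('b) * a mod (CARD('f) - 1) \<in> A"
  obtains c where "\<And>i. i < card A \<Longrightarrow> poly (expo_poly A c) (\<omega> powi (r + int i)) = emb (y i)"
    "range (poly (expo_poly A c)) \<subseteq> range emb"
proof -
  let ?z = "\<lambda>i. \<omega> powi (r + int i)"
  let ?ev = "\<lambda>c. \<lambda>i\<in>{..<card A}. poly (expo_poly A c) (?z i)"
  let ?X = "A \<rightarrow>\<^sub>E (UNIV :: 'f set)" and ?Y = "{..<card A} \<rightarrow>\<^sub>E (UNIV :: 'f set)"
  have finA: "finite A" using A finite_subset by blast
  \<comment> \<open>Interpolation follows by counting: evaluation is injective, and its source and
    target are finite sets of the same size.\<close>
  have "inj_on ?ev ?X"
  proof (rule inj_onI)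
    fix c c' assume c: "c \<in> ?X" "c' \<in> ?X" "?ev c = ?ev c'"
    have "poly (expo_poly A c) (?z i) = poly (expo_poly A c') (?z i)" if "i < card A" for i
      using fun_cong[OF c(3), of i] that by simp
    then have "expo_poly A c = expo_poly A c'" by (rule expo_poly_agree[OF \<omega> A])
    then show "c = c'" using c(1,2) expo_poly_eq_iff[OF A] by (intro PiE_ext) auto
  qed
  moreover have "?ev ` ?X \<subseteq> ?Y" by (intro image_subsetI) (simp add: restrict_PiE_iff)
  moreover have "card ?X = card ?Y" "finite ?Y" using finA by (simp_all add: card_funcsetE finite_PiE)
  ultimately have "?ev ` ?X = ?Y" by (metis card_image card_subset_eq)
  moreover have "(\<lambda>i\<in>{..<card A}. emb (y i)) \<in> ?Y" by auto
  ultimately obtain c where c: "(\<lambda>i\<in>{..<card A}. emb (y i)) = ?ev c" by (metis (no_types, lifting) imageE)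
  have ev: "poly (expo_poly A c) (?z i) = emb (y i)" if "i < card A" for i
    using fun_cong[OF c, of i] that by simp
  obtain c' where c': "\<And>x. poly (expo_poly A c') x = poly (expo_poly A c) x ^ CARD('b)"
    using expo_poly_frobenius[OF A closed] by metis
  have "expo_poly A c' = expo_poly A c"
    by (rule expo_poly_agree[OF \<omega> A, where r = r]) (simp add: c' ev emb_power_card)
  then have "poly (expo_poly A c) x \<in> range emb" for x
    using c' by (intro range_embI[OF emb]) metis
  with ev show ?thesis by (intro that) auto
qed

section \<open>The trace form\<close>

abbreviation "tr \<equiv> field_trace emb t"

lemma emb_tr: "emb (tr x) = (\<Sum>i<t. x ^ CARD('b) ^ i)"
  by (rule emb_field_trace[OF emb card_F])

lemma power_card_power_add: "(x + y) ^ CARD('b) ^ i = x ^ CARD('b) ^ i + y ^ CARD('b) ^ i" for x y :: 'f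
  by (induction i arbitrary: x y) (simp_all add: power_mult power_card_add[OF emb])

lemma tr_add: "tr (x + y) = tr x + tr y"
proof -
  have "emb (tr (x + y)) = emb (tr x + tr y)"
    by (simp add: emb_add emb_tr power_card_power_add sum.distrib)
  then show ?thesis by (simp only: emb_eq_iff)
qed

lemma tr_0: "tr 0 = 0"
  using tr_add[of 0 0] by (metis add.right_neutral add_left_cancel)

lemma tr_diff: "tr (x - y) = tr x - tr y"
  using tr_add[of "x - y" y] by simp

lemma tr_sum: "tr (\<Sum>i\<in>A. f i) = (\<Sum>i\<in>A. tr (f i))"
  by (induction A rule: infinite_finite_induct) (simp_all add: tr_0 tr_add)

lemma tr_scale: "tr (emb b * x) = b * tr x"
proof -
  have "emb (tr (emb b * x)) = emb (b * tr x)"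
    by (simp add: emb_mult emb_tr power_mult_distrib emb_power_card_power sum_distrib_left)
  then show ?thesis by (simp only: emb_eq_iff)
qed

lemma power_card_exponent: "CARD('b) ^ i = 1 \<longleftrightarrow> i = 0"
  using CARD_finite_field_ge_2[where 'a='b] by simp

text \<open>Otherwise the trace would vanish identically, although its polynomial has degree below
  \<open>n\<close> and coefficient 1 at \<open>x\<close>.\<close>

lemma tr_nondegenerate:
  assumes "\<And>\<gamma>. tr (\<gamma> * y) = 0"
  shows "y = 0"
proof (rule ccontr)
  assume y: "y \<noteq> 0"
  let ?P = "\<Sum>i<t. monom 1 (CARD('b) ^ i) :: 'f poly"
  have root: "poly ?P z = 0" for z
  proof -
    have "tr z = 0" using assms[of "z / y"] y by simp
    then have "emb (tr z) = 0" by (simp add: emb_0)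
    then show ?thesis by (simp add: emb_tr poly_sum poly_monom)
  qed
  have "degree ?P \<le> CARD('b) ^ (t - 1)"
  proof (rule degree_sum_le)
    fix i assume "i \<in> {..<t}"
    then have "CARD('b) ^ i \<le> CARD('b) ^ (t - 1)" by (intro power_increasing) auto
    then show "degree (monom 1 (CARD('b) ^ i) :: 'f poly) \<le> CARD('b) ^ (t - 1)"
      by (simp add: degree_monom_eq)
  qed simp
  also have "\<dots> < CARD('b) ^ t"
    using CARD_finite_field_ge_2[where 'a='b] t_pos by (intro power_strict_increasing) auto
  finally have "?P = 0" using root by (intro poly_eq_card) (auto simp: card_F)
  then have "coeff ?P 1 = 0" by simp
  moreover have "coeff ?P 1 = (\<Sum>i<t. if i = 0 then 1 else 0)"
    unfolding coeff_sum coeff_monom power_card_exponent ..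
  ultimately show False using t_pos by simp
qed

text \<open>This is \<open>Tr(\<gamma> x) / x\<close> as a genuine polynomial, which therefore also
  has a value at 0.\<close>

definition tr_poly :: "'f \<Rightarrow> 'f poly" where
  "tr_poly \<gamma> = (\<Sum>i<t. monom (\<gamma> ^ CARD('b) ^ i) (CARD('b) ^ i - 1))"

lemma poly_tr_poly: "x * poly (tr_poly \<gamma>) x = emb (tr (\<gamma> * x))"
proof -
  have "x * (c * x ^ (CARD('b) ^ i - 1)) = c * x ^ CARD('b) ^ i" for c i
    using power_minus_mult[of "CARD('b) ^ i" x] by (simp add: mult_ac)
  then show ?thesis
    unfolding tr_poly_def poly_sum poly_monom emb_tr sum_distrib_left
    by (simp only: power_mult_distrib)
qed

lemma poly_tr_poly_0: "poly (tr_poly \<gamma>) 0 = \<gamma>"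
proof -
  have "poly (tr_poly \<gamma>) 0 = (\<Sum>i<t. if i = 0 then \<gamma> else 0)"
    unfolding tr_poly_def poly_sum poly_monom
  proof (rule sum.cong)
    fix i
    have "CARD('b) ^ i \<ge> 1" by simp
    then have "CARD('b) ^ i - 1 = 0 \<longleftrightarrow> i = 0"
      using power_card_exponent[of i] by linarith
    then show "\<gamma> ^ CARD('b) ^ i * 0 ^ (CARD('b) ^ i - 1) = (if i = 0 then \<gamma> else 0)"
      by (auto simp: power_0_left)
  qed simp
  then show ?thesis using t_pos by simp
qed

lemma degree_tr_poly: "degree (tr_poly \<gamma>) \<le> CARD('b) ^ (t - 1) - 1"
  unfolding tr_poly_def
proof (rule degree_sum_le)
  fix i assume "i \<in> {..<t}"
  then have "CARD('b) ^ i \<le> CARD('b) ^ (t - 1)" by (intro power_increasing) auto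
  then show "degree (monom (\<gamma> ^ CARD('b) ^ i) (CARD('b) ^ i - 1)) \<le> CARD('b) ^ (t - 1) - 1"
    by (meson degree_monom_le diff_le_mono order_trans)
qed simp

end

text \<open>The product with the message polynomial has degree at most \<open>n - 2\<close>, and
  such polynomials sum to 0 over the field.\<close>

lemma RS_parity:
  fixes p :: "'f::finite_field poly"
  assumes "v \<in> RS k" "1 \<le> k" "degree p + k < CARD('f)"
  shows "(\<Sum>\<alpha>\<in>UNIV. poly p \<alpha> * v $ \<alpha>) = 0"
proof -
  obtain c where c: "v = (\<chi> \<alpha>. poly c \<alpha>)" "degree c \<le> k - 1" using assms(1) by (auto simp: RS_def)
  have "degree (p * c) < CARD('f) - 1" using degree_mult_le[of p c] c(2) assms by linarith
  then have "(\<Sum>\<alpha>\<in>UNIV. poly (p * c) \<alpha>) = 0" by (rule sum_poly_finite_field)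
  then show ?thesis by (simp add: c(1))
qed

section \<open>The repair scheme\<close>

text \<open>The hypothesis \<open>size\<close> is the bound on \<open>s\<close> from
  \<open>recorded_admissible\<close>, and \<open>d\<close> is taken as the number of admissible
  exponents; the theorem identifies it with the sum of coset sizes.\<close>

locale repair_scheme = field_extension emb t
  for emb :: "'b::finite_field \<Rightarrow> 'f::finite_field" and t +
  fixes \<omega> :: 'f and r :: int and k :: nat and S :: "'f set" and A :: "nat set" and d :: nat
    and node :: "nat \<Rightarrow> 'f" and I :: "'f set" and V :: "'f poly set"
  defines "A \<equiv> admissible CARD('b) t (CARD('f) - k - card S)"
    and "d \<equiv> card A"
    and "node \<equiv> \<lambda>i. \<omega> powi (r + int i)"
    and "I \<equiv> node ` {..<d}"
    and "V \<equiv> V_space emb k S"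
  assumes prim: "primitive_element \<omega>" and k_pos: "1 \<le> k"
    and size: "card S + k + CARD('b) ^ (t - 1) \<le> CARD('f)"
    and S_0: "0 \<notin> S" and S_I: "S \<inter> I = {}"
begin

section \<open>The space \<open>V\<close> and its basis dual to the nodes\<close>

lemma S_k: "k + card S < CARD('f)"
proof -
  have "CARD('b) ^ (t - 1) > 0" by simp
  with size show ?thesis by linarith
qed

lemma A_subset: "A \<subseteq> {..<CARD('f) - 1}"
  unfolding A_def by (rule admissible_subset)

lemma V_expo_poly: "T \<in> V \<longleftrightarrow> range (poly T) \<subseteq> range emb \<and> (\<exists>c. T = expo_poly A c)"
  unfolding V_def A_def V_space_eq[OF S_0 k_pos S_k] by simp

lemma V_agree:
  assumes "T \<in> V" "T' \<in> V" "\<And>i. i < d \<Longrightarrow> poly T (node i) = poly T' (node i)"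
  shows "T = T'"
proof -
  obtain c c' where "T = expo_poly A c" "T' = expo_poly A c'" using assms V_expo_poly by metis
  then show ?thesis using expo_poly_agree[OF prim A_subset, of c r c'] assms(3)
    by (simp add: node_def d_def)
qed

definition val :: "'f poly \<Rightarrow> 'f \<Rightarrow> 'b" where
  "val T \<alpha> = the_inv emb (poly T \<alpha>)"

lemma emb_val: "T \<in> V \<Longrightarrow> emb (val T \<alpha>) = poly T \<alpha>"
  unfolding val_def V_expo_poly by (intro emb_the_inv) blast

lemma V_sum:
  assumes "finite J" "\<And>i. i \<in> J \<Longrightarrow> e i \<in> V"
  shows "(\<Sum>i\<in>J. smult (emb (c i)) (e i)) \<in> V"
proof -
  let ?T = "\<Sum>i\<in>J. smult (emb (c i)) (e i)"
  note iff = V_space_iff[OF S_0 k_pos S_k, of _ emb, folded V_def]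
  have "poly ?T x = emb (\<Sum>i\<in>J. c i * val (e i) x)" for x
    using assms(2) by (simp add: poly_sum emb_sum emb_mult emb_val)
  then have "range (poly ?T) \<subseteq> range emb" by auto
  moreover have "degree ?T \<le> CARD('f) - k - card S"
    using assms iff by (intro degree_sum_le) (auto intro: order_trans[OF degree_smult_le])
  moreover have "coeff ?T 0 = 0" "coeff ?T 1 = 0"
    using assms(2) iff by (simp_all add: coeff_sum)
  ultimately show ?thesis using iff by blast
qed

text \<open>A Lagrange basis of \<open>V\<close> for the nodes, supplied by
  \<open>base_field_interpolation\<close>. For \<open>i \<ge> d\<close> all prescribed values are 0,
  so \<open>dual i\<close> lies in \<open>V\<close> for every \<open>i\<close>.\<close>

definition dual :: "nat \<Rightarrow> 'f poly" where
  "dual i = (SOME T. T \<in> V \<and> (\<forall>j<d. val T (node j) = (if j = i then 1 else 0)))"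

lemma dual: "dual i \<in> V" "j < d \<Longrightarrow> val (dual i) (node j) = (if j = i then 1 else 0)"
proof -
  have closed: "CARD('b) * a mod (CARD('f) - 1) \<in> A" if "a \<in> A" for a
    using admissible_closed that unfolding A_def card_F by blast
  obtain c where c: "\<And>j. j < card A \<Longrightarrow> poly (expo_poly A c) (\<omega> powi (r + int j)) = emb (if j = i then 1 else 0)"
    "range (poly (expo_poly A c)) \<subseteq> range emb"
    using base_field_interpolation[OF prim A_subset closed, of r "\<lambda>j. if j = i then 1 else 0"] by blast
  then have V: "expo_poly A c \<in> V" using V_expo_poly by blast
  have "val (expo_poly A c) (node j) = (if j = i then 1 else 0)" if "j < d" for j
    using c(1)[of j] that emb_val[OF V, of "node j"] unfolding d_def node_def
    by (metis emb_eq_iff)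
  with V have "\<exists>T. T \<in> V \<and> (\<forall>j<d. val T (node j) = (if j = i then 1 else 0))" by blast
  then have "dual i \<in> V \<and> (\<forall>j<d. val (dual i) (node j) = (if j = i then 1 else 0))"
    unfolding dual_def by (rule someI_ex)
  then show "dual i \<in> V" "j < d \<Longrightarrow> val (dual i) (node j) = (if j = i then 1 else 0)" by auto
qed

lemma poly_dual: "j < d \<Longrightarrow> poly (dual i) (node j) = (if j = i then 1 else 0)"
  using emb_val[OF dual(1), of i "node j"] dual(2)[of j i] emb_0 emb_1 by metis

lemma V_expand:
  assumes "T \<in> V"
  shows "T = (\<Sum>i<d. smult (emb (val T (node i))) (dual i))"
proof (rule V_agree)
  show "(\<Sum>i<d. smult (emb (val T (node i))) (dual i)) \<in> V" by (rule V_sum) (simp_all add: dual)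
  show "poly T (node j) = poly (\<Sum>i<d. smult (emb (val T (node i))) (dual i)) (node j)" if "j < d" for j
    using that assms by (simp add: poly_sum poly_dual emb_val if_distrib cong: if_cong)
qed (rule assms)

lemma dim_V: "poly_dim emb (V_space emb k S) = d"
proof -
  have "poly_dim emb V = card {..<d}" unfolding poly_dim_def
  proof (rule vector_space.dim_eq_card_basis_family[OF vector_space_poly[OF emb]])
    show "\<exists>c. T = (\<Sum>i<d. smult (emb (c i)) (dual i))" if "T \<in> V" for T
      by (rule exI, rule V_expand[OF that])
    show "a j = 0" if sum0: "(\<Sum>i<d. smult (emb (a i)) (dual i)) = 0" and j: "j \<in> {..<d}" for a j
    proof -
      have "poly (\<Sum>i<d. smult (emb (a i)) (dual i)) (node j) = emb (a j)"
        using j by (simp add: poly_sum poly_dual if_distrib cong: if_cong)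
      then have "emb (a j) = emb 0" using sum0 by (simp add: emb_0)
      then show ?thesis by (simp only: emb_eq_iff)
    qed
  qed (simp_all add: dual)
  then show ?thesis by (simp add: V_def)
qed

lemma node_nonzero: "node i \<noteq> 0"
  using prim by (simp add: node_def primitive_element_def)

lemma g_node_nonzero: "i < d \<Longrightarrow> poly (g_poly S) (node i) \<noteq> 0"
  using S_I unfolding poly_g_poly_eq_0_iff I_def by blast

text \<open>The weights \<open>g(\<alpha>) / \<alpha>\<close> are nonzero on \<open>I\<close>, whose
  elements are nonzero and avoid \<open>S\<close>. Hence the evaluation vectors of the dual basis
  stay independent.\<close>

lemma dim_W: "vec_dim emb (W_space emb k S) = d"
proof -
  define w :: "'f poly \<Rightarrow> ('f, 'f) vec"
    where "w T = (\<chi> \<alpha>. poly (g_poly S) \<alpha> * poly T \<alpha> / \<alpha>)" for T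
  have W: "W_space emb k S = w ` V"
    unfolding W_space_def V_def w_def by (intro image_cong refl) (simp only: vec_eq_iff vec_lambda_beta poly_h_poly simp_thms)
  have lin: "w (\<Sum>i\<in>J. smult (c i) (e i)) = (\<Sum>i\<in>J. c i *s w (e i))" for J c and e :: "nat \<Rightarrow> 'f poly"
    by (simp add: w_def vec_eq_iff poly_sum sum_distrib_left sum_divide_distrib mult_ac)
  have "vec_dim emb (W_space emb k S) = card {..<d}" unfolding vec_dim_def
  proof (rule vector_space.dim_eq_card_basis_family[OF vector_space_vec[OF emb]])
    show "w (dual i) \<in> W_space emb k S" for i unfolding W by (intro imageI dual)
    show "\<exists>c. x = (\<Sum>i<d. emb (c i) *s w (dual i))" if x: "x \<in> W_space emb k S" for x
    proof -
      obtain T where "T \<in> V" "x = w T" using x unfolding W by auto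
      then have "x = (\<Sum>i<d. emb (val T (node i)) *s w (dual i))"
        using V_expand[of T] lin[of "\<lambda>i. emb (val T (node i))" dual "{..<d}"] by simp
      then show ?thesis by (intro exI[of _ "\<lambda>i. val T (node i)"])
    qed
    show "a j = 0" if sum0: "(\<Sum>i<d. emb (a i) *s w (dual i)) = 0" and j: "j \<in> {..<d}" for a j
    proof -
      have "w (\<Sum>i<d. smult (emb (a i)) (dual i)) $ node j = 0" unfolding lin sum0 by simp
      moreover have "poly (\<Sum>i<d. smult (emb (a i)) (dual i)) (node j) = emb (a j)"
        using j by (simp add: poly_sum poly_dual if_distrib cong: if_cong)
      ultimately have "emb (a j) = emb 0"
        using node_nonzero[of j] g_node_nonzero[of j] j by (simp add: w_def emb_0)
      then show ?thesis by (simp only: emb_eq_iff)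
    qed
  qed simp
  then show ?thesis by simp
qed

section \<open>Parity checks, recovery and bandwidth\<close>

abbreviation "query \<equiv> trace_query emb t S"
abbreviation "D \<equiv> (UNIV - {0}) - (I \<union> S)"

text \<open>Division by 0 and the roots of \<open>g\<close> make these queries trivial, so 0 and
  \<open>S\<close> can stay in parity sums without being downloaded.\<close>

lemma query_0: "query 0 y = 0" and query_S: "\<alpha> \<in> S \<Longrightarrow> query \<alpha> y = 0"
proof -
  show "query 0 y = 0" by (simp add: trace_query_def tr_0)
  show "query \<alpha> y = 0" if "\<alpha> \<in> S"
    using that poly_g_poly_eq_0_iff[of S \<alpha>] by (simp add: trace_query_def tr_0)
qed

text \<open>Take the trace of the parity check given by \<open>h\<close>: the values of
  \<open>T\<close> lie in the base field and come out of the trace as scalars.\<close>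

lemma V_parity:
  assumes T: "T \<in> V" and v: "v \<in> RS k"
  shows "(\<Sum>\<alpha>\<in>UNIV. val T \<alpha> * query \<alpha> (v $ \<alpha>)) = 0"
proof -
  have "degree (h_poly S T) \<le> CARD('f) - k - 1" using T by (simp add: V_def V_space_def)
  then have "(\<Sum>\<alpha>\<in>UNIV. poly (h_poly S T) \<alpha> * v $ \<alpha>) = 0"
    using S_k k_pos by (intro RS_parity[OF v]) linarith+
  also have "(\<Sum>\<alpha>\<in>UNIV. poly (h_poly S T) \<alpha> * v $ \<alpha>) =
    (\<Sum>\<alpha>\<in>UNIV. emb (val T \<alpha>) * (poly (g_poly S) \<alpha> * v $ \<alpha> / \<alpha>))"
    using T by (intro sum.cong) (simp_all add: poly_h_poly[of T emb k S] V_def[symmetric] emb_val)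
  finally have "tr (\<Sum>\<alpha>\<in>UNIV. emb (val T \<alpha>) * (poly (g_poly S) \<alpha> * v $ \<alpha> / \<alpha>)) = 0"
    by (simp add: tr_0)
  then show ?thesis by (simp only: tr_sum tr_scale trace_query_def)
qed

text \<open>In the check of \<open>dual i\<close>, node \<open>i\<close> has weight 1, the other
  nodes of \<open>I\<close> have weight 0, and 0 and \<open>S\<close> have zero queries. Everything
  else is downloaded.\<close>

lemma recover_node:
  assumes v: "v \<in> RS k" and i: "i < d"
  shows "query (node i) (v $ node i) = - (\<Sum>\<beta>\<in>D. val (dual i) \<beta> * query \<beta> (v $ \<beta>))"
proof -
  let ?f = "\<lambda>\<beta>. val (dual i) \<beta> * query \<beta> (v $ \<beta>)"
  have "(\<Sum>\<beta>\<in>insert (node i) D. ?f \<beta>) = (\<Sum>\<beta>\<in>UNIV. ?f \<beta>)"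
  proof (intro sum.mono_neutral_left ballI)
    fix \<beta> assume "\<beta> \<in> UNIV - insert (node i) D"
    then consider "\<beta> = 0" | "\<beta> \<in> S" | j where "j < d" "\<beta> = node j" "j \<noteq> i" by (auto simp: I_def)
    then show "?f \<beta> = 0" by cases (auto simp: query_0 query_S dual)
  qed auto
  also have "\<dots> = 0" using V_parity dual v by blast
  finally have "?f (node i) + (\<Sum>\<beta>\<in>D. ?f \<beta>) = 0" using i by (simp add: I_def)
  then show ?thesis using i by (simp add: dual eq_neg_iff_add_eq_0)
qed

lemma recoverable_I: "recoverable k query D I"
  unfolding recoverable_def
proof (intro exI ballI)
  let ?i = "inv_into {..<d} node"
  fix v :: "('f, 'f) vec" and \<alpha> assume v: "v \<in> RS k" and \<alpha>: "\<alpha> \<in> I"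
  have "?i \<alpha> < d" "node (?i \<alpha>) = \<alpha>"
    using \<alpha> inv_into_into[of \<alpha> node "{..<d}"] f_inv_into_f[of \<alpha> node "{..<d}"] by (auto simp: I_def)
  then show "(\<lambda>f \<alpha>. - (\<Sum>\<beta>\<in>D. val (dual (?i \<alpha>)) \<beta> * f \<beta>)) (\<lambda>\<beta>\<in>D. query \<beta> (v $ \<beta>)) \<alpha>
    = query \<alpha> (v $ \<alpha>)"
    using recover_node[OF v, of "?i \<alpha>"] by simp
qed

text \<open>
  The parity check polynomial \<open>g(x) Tr(\<gamma> x) / x\<close> takes the value \<open>g(0) \<gamma>\<close> at 0; its degree
  is small enough because \<open>|S| \<le> n - k - q ^ (t - 1)\<close>.
\<close>

lemma tr_origin:
  assumes v: "v \<in> RS k"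
  shows "tr (\<gamma> * (poly (g_poly S) 0 * v $ 0)) = - (\<Sum>\<alpha>\<in>UNIV - {0}. tr (\<gamma> * \<alpha>) * query \<alpha> (v $ \<alpha>))"
proof -
  let ?p = "g_poly S * tr_poly \<gamma>"
  have "CARD('b) ^ (t - 1) > 0" by simp
  moreover have "degree ?p \<le> card S + (CARD('b) ^ (t - 1) - 1)"
    using degree_mult_le[of "g_poly S" "tr_poly \<gamma>"] degree_tr_poly[of \<gamma>] unfolding degree_g_poly by linarith
  ultimately have "degree ?p + k < CARD('f)" using size by linarith
  then have "(\<Sum>\<alpha>\<in>UNIV. poly ?p \<alpha> * v $ \<alpha>) = 0" using k_pos by (intro RS_parity[OF v])
  moreover have "(\<Sum>\<alpha>\<in>UNIV. poly ?p \<alpha> * v $ \<alpha>) =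
      \<gamma> * (poly (g_poly S) 0 * v $ 0) + (\<Sum>\<alpha>\<in>UNIV - {0}. poly ?p \<alpha> * v $ \<alpha>)"
    by (subst sum.remove[of _ 0]) (simp_all add: poly_tr_poly_0 mult_ac)
  moreover have "(\<Sum>\<alpha>\<in>UNIV - {0}. poly ?p \<alpha> * v $ \<alpha>) =
      (\<Sum>\<alpha>\<in>UNIV - {0}. emb (tr (\<gamma> * \<alpha>)) * (poly (g_poly S) \<alpha> * v $ \<alpha> / \<alpha>))"
    by (intro sum.cong) (simp_all flip: poly_tr_poly)
  ultimately have "\<gamma> * (poly (g_poly S) 0 * v $ 0) +
      (\<Sum>\<alpha>\<in>UNIV - {0}. emb (tr (\<gamma> * \<alpha>)) * (poly (g_poly S) \<alpha> * v $ \<alpha> / \<alpha>)) = 0" by simp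
  then have "tr (\<gamma> * (poly (g_poly S) 0 * v $ 0) +
      (\<Sum>\<alpha>\<in>UNIV - {0}. emb (tr (\<gamma> * \<alpha>)) * (poly (g_poly S) \<alpha> * v $ \<alpha> / \<alpha>))) = tr 0"
    by (rule arg_cong)
  then show ?thesis
    unfolding tr_add tr_sum tr_scale tr_0 trace_query_def by (simp only: eq_neg_iff_add_eq_0)
qed

text \<open>Equal downloads give equal queries at every node, so by \<open>tr_origin\<close> all
  traces of multiples of \<open>g(0)\<close> times the symbol at 0 agree. Nondegeneracy and
  \<open>g(0) \<noteq> 0\<close> then recover the symbol.\<close>

lemma repairs_origin_D: "repairs_origin k query D"
proof (rule repairs_originI)
  fix v w :: "('f, 'f) vec"
  assume v: "v \<in> RS k" and w: "w \<in> RS k" and eq: "\<forall>\<beta>\<in>D. query \<beta> (v $ \<beta>) = query \<beta> (w $ \<beta>)"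
  have "query \<alpha> (v $ \<alpha>) = query \<alpha> (w $ \<alpha>)" for \<alpha>
  proof -
    consider "\<alpha> \<in> D" | "\<alpha> = 0" | "\<alpha> \<in> S" | i where "i < d" "\<alpha> = node i" by (auto simp: I_def)
    then show ?thesis
    proof cases
      case 4
      have "(\<Sum>\<beta>\<in>D. val (dual i) \<beta> * query \<beta> (v $ \<beta>)) = (\<Sum>\<beta>\<in>D. val (dual i) \<beta> * query \<beta> (w $ \<beta>))"
        using eq by (intro sum.cong) simp_all
      then show ?thesis using 4 recover_node v w by simp
    qed (use eq in \<open>auto simp: query_0 query_S\<close>)
  qed
  then have "tr (\<gamma> * (poly (g_poly S) 0 * v $ 0)) = tr (\<gamma> * (poly (g_poly S) 0 * w $ 0))" for \<gamma>
    unfolding tr_origin[OF v] tr_origin[OF w] by simp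
  then have "tr (\<gamma> * (poly (g_poly S) 0 * v $ 0 - poly (g_poly S) 0 * w $ 0)) = 0" for \<gamma>
    by (simp add: right_diff_distrib tr_diff)
  then have "poly (g_poly S) 0 * v $ 0 - poly (g_poly S) 0 * w $ 0 = 0" by (rule tr_nondegenerate)
  then show "v $ 0 = w $ 0" using S_0 poly_g_poly_eq_0_iff[of S 0] by simp
qed blast

text \<open>The nodes are distinct since \<open>d \<le> n - 1\<close>, and \<open>{0}\<close>,
  \<open>I\<close> and \<open>S\<close> are disjoint. The additive form avoids natural
  subtraction.\<close>

lemma card_D: "card D + d + card S + 1 = CARD('f)"
proof -
  have "inj_on node {..<d}"
  proof (rule inj_onI)
    fix i j assume ij: "i \<in> {..<d}" "j \<in> {..<d}" "node i = node j"
    have "\<omega> \<noteq> 0" using prim by (simp add: primitive_element_def)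
    then have "\<omega> ^ i = \<omega> ^ j" using ij(3) by (simp add: node_def power_int_add)
    moreover have "d \<le> CARD('f) - 1"
      using card_mono[OF _ A_subset] by (simp add: d_def)
    ultimately show "i = j" using inj_on_primitive_power[OF prim] ij(1,2) by (auto simp: inj_on_def)
  qed
  then have I: "card I = d" by (simp add: I_def card_image)
  have 0: "0 \<notin> I" using node_nonzero by (auto simp: I_def)
  have "D = UNIV - ({0} \<union> I \<union> S)" by blast
  moreover have "card ({0} \<union> I \<union> S) = 1 + d + card S"
    using I 0 S_0 S_I by (subst card_Un_disjoint) (auto simp: card_Un_disjoint)
  moreover have "card (UNIV - ({0} \<union> I \<union> S)) + card ({0} \<union> I \<union> S) = CARD('f)"
    by (metis card_Diff_subset card_mono finite le_add_diff_inverse2 subset_UNIV)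
  ultimately show ?thesis by simp
qed

end

theorem corollary10:
  fixes emb :: "'b::finite_field \<Rightarrow> 'f::finite_field"
    and q t n k s R d :: nat
    and r :: int
    and \<omega> :: 'f
    and U :: "nat set set"
    and I S :: "'f set"
  assumes "field_embedding emb"
    and "CARD('b) = q"
    and "t \<ge> 1"
    and "n = q ^ t"
    and "CARD('f) = n"
    and "primitive_element \<omega>"
    and "1 \<le> k" and "k \<le> n - q ^ (t - 1)"
    and "algorithm_O_output q t k (U, s, R)"
    and "d = (\<Sum>C\<in>U. card C)"
    and "I = {\<omega> powi (r + int i) | i. i < d}"
    and "S \<subseteq> (UNIV - {0}) - I"
    and "card S = s"
  shows "poly_dim emb (V_space emb k S) = d \<and>
         vec_dim emb (W_space emb k S) = d \<and>
         R = card S + vec_dim emb (W_space emb k S) \<and>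
         recoverable k (trace_query emb t S) ((UNIV - {0}) - (I \<union> S)) I \<and>
         repairs_origin k (trace_query emb t S) ((UNIV - {0}) - (I \<union> S)) \<and>
         bandwidth (trace_query emb t S) ((UNIV - {0}) - (I \<union> S))
           = (real n - 1 - real R) * log 2 (real q)"
proof -
  have "(U, s, R) \<in> recorded q t k" using assms(9) by (simp add: algorithm_O_output_def)
  moreover have "q \<ge> 2" using CARD_finite_field_ge_2[where 'a='b] assms(2) by simp
  ultimately have rec: "U \<subseteq> cyclotomic_cosets q t" "R = s + d" "s + k + q ^ (t - 1) \<le> n"
    "\<Union>U = admissible q t (n - k - s)"
    using recorded_admissible[of U s R q t k] assms by simp_all
  have d: "d = card (admissible q t (n - k - s))"
    using card_Union_cosets[OF rec(1)] rec(4) assms(10) by simp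
  have I: "I = (\<lambda>i. \<omega> powi (r + int i)) ` {..<d}" using assms(11) by auto
  interpret repair_scheme emb t \<omega> r k S "admissible CARD('b) t (CARD('f) - k - card S)"
    "card (admissible CARD('b) t (CARD('f) - k - card S))" "\<lambda>i. \<omega> powi (r + int i)"
    "(\<lambda>i. \<omega> powi (r + int i)) ` {..<card (admissible CARD('b) t (CARD('f) - k - card S))}"
    "V_space emb k S"
  proof unfold_locales
    show "field_embedding emb" "primitive_element \<omega>" "1 \<le> k" by (rule assms)+
    show "CARD('f) = CARD('b) ^ t" using assms by simp
    show "card S + k + CARD('b) ^ (t - 1) \<le> CARD('f)" using rec(3) assms by simp
    show "0 \<notin> S" using assms(12) by blast
    have "S \<inter> I = {}" using assms(12) by blast
    then show "S \<inter> (\<lambda>i. \<omega> powi (r + int i)) ` {..<card (admissible CARD('b) t (CARD('f) - k - card S))} = {}"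
      unfolding I d assms(2,5,13) .
  qed
  have d': "card (admissible CARD('b) t (CARD('f) - k - card S)) = d" using d assms by simp
  note facts = dim_V dim_W recoverable_I repairs_origin_D card_D
  note facts' = facts[unfolded d', folded I]
  have "real (card ((UNIV - {0}) - (I \<union> S))) = real n - 1 - real R"
    using facts'(5) rec(2) assms(5,13) by linarith
  then have "bandwidth (trace_query emb t S) ((UNIV - {0}) - (I \<union> S))
           = (real n - 1 - real R) * log 2 (real q)"
    using assms(2) by (simp add: bandwidth_def)
  then show ?thesis using facts' rec(2) assms(13) by simp
qed

end
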